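(* Let $q$ be a prime power, $e\ge 2$ an integer, $V$ a $(2e+1)$-dimensional vector space over $\mathrm{GF}(q)$, $H$ a hyperplane of $V$, and $\sigma$ a polarity of $H$. Let $([V],\mathcal{A}'\cup\mathcal{B}')$ be the design defined from $V,H,\sigma$ in the context. Then every automorphism of the design $([V],\mathcal{A}'\cup\mathcal{B}')$ is of the form $\phi'$ for some $\phi\in\Gamma\mathrm{L}(V)_H$, where $\phi'$ is the permutation of $[V]$ given by $$\phi'(\langle x\rangle)=\begin{cases}\sigma\phi\sigma(\langle x\rangle)&\text{if }\langle x\rangle\in[H],\\ \phi(\langle x\rangle)&\text{otherwise,}\end{cases}$$ and the full automorphism group of the design $([V],\mathcal{A}'\cup\mathcal{B}')$ is isomorphic to $P\Gamma\mathrm{L}(V)_H$.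
   Context: Let $q$ be a prime power, $e\ge 2$ an integer, $V$ a $(2e+1)$-dimensional vector space over $\mathrm{GF}(q)$, and $H$ a fixed hyperplane of $V$ (a linear subspace of dimension $2e$). Notation. If $W\subseteq V$ is a subset closed under multiplication by elements of $\mathrm{GF}(q)$, then $[W]$ denotes the set of $1$-dimensional subspaces of $V$ contained in $W$. For a vector space $W$, $\genfrac{[}{]}{0pt}{}{W}{k}$ denotes the set of $k$-dimensional subspaces of $W$. For nonzero $x\in V$, $\langle x\rangle$ denotes the $1$-dimensional subspace spanned by $x$. Polarity. A polarity $\sigma$ of $H$ is an inclusion-reversing permutation of the set of all linear subspaces of $H$ such that $\sigma^2$ is the identity. The design. The incidence structure $([V],\mathcal{A}'\cup\mathcal{B}')$ has point set $[V]$ and block set $\mathcal{A}'\cup\mathcal{B}'$ (blocks are subsets of $[V]$), where, with $\mathcal{A}=\left\{W\in\genfrac{[}{]}{0pt}{}{V}{e+1}\;\middle|\; W\not\subset H\right\}$, $$\mathcal{A}'=\{[\sigma(W\cap H)\cup(W\setminus H)]\mid W\in\mathcal{A}\},\qquad \mathcal{B}'=\left\{[W]\;\middle|\; W\in\genfrac{[}{]}{0pt}{}{H}{e+1}\right\}.$$ An automorphism of the design is a permutation of $[V]$ that maps the set of blocks $\mathcal{A}'\cup\mathcal{B}'$ onto itself. Groups. $\Gamma\mathrm{L}(V)$ is the general semilinear group on $V$ (all bijective semilinear maps $V\to V$), and $\Gamma\mathrm{L}(V)_H$ is the stabilizer of $H$ in it. $P\Gamma\mathrm{L}(V)_H$ is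 the stabilizer of $H$ in the projective semilinear group $P\Gamma\mathrm{L}(V)$, i.e. the quotient of $\Gamma\mathrm{L}(V)_H$ by the group of nonzero scalar maps. Elements $\phi\in\Gamma\mathrm{L}(V)_H$ act on subspaces of $V$ (and of $H$) by taking images; in $\sigma\phi\sigma(\langle x\rangle)$ with $\langle x\rangle\in[H]$, the maps are composed as maps on the set of subspaces of $H$. *)

theory Defs
  imports
    "HOL-Algebra.Bij"
    "HOL-Algebra.Coset"
    "HOL-Number_Theory.Prime_Powers"
begin

text \<open>
  The ambient space is the whole vector type of a \<^locale>\<open>vector_space\<close>.
  Points are the 1-dimensional subspaces themselves, and blocks are sets of points.
\<close>

locale projective_geometry = vector_space scale
  for scale :: "'a::field \<Rightarrow> 'b::ab_group_add \<Rightarrow> 'b"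
begin

definition points :: "'b set \<Rightarrow> 'b set set" where
  "points W = {P. subspace P \<and> dim P = 1 \<and> P \<subseteq> W}"

definition subspaces_of :: "'b set \<Rightarrow> 'b set set" where
  "subspaces_of W = {U. subspace U \<and> U \<subseteq> W}"

definition subspaces_of_dim :: "'b set \<Rightarrow> nat \<Rightarrow> 'b set set" where
  "subspaces_of_dim W k = {U \<in> subspaces_of W. dim U = k}"

text \<open>The values of a polarity of \<open>H\<close> outside the subspaces of \<open>H\<close> are unconstrained.\<close>

definition polarity :: "'b set \<Rightarrow> ('b set \<Rightarrow> 'b set) \<Rightarrow> bool" where
  "polarity H \<sigma> \<longleftrightarrow>
     bij_betw \<sigma> (subspaces_of H) (subspaces_of H) \<and>
     (\<forall>U\<in>subspaces_of H. \<forall>W\<in>subspaces_of H. U \<subseteq> W \<longrightarrow> \<sigma> W \<subseteq> \<sigma> U) \<and>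
     (\<forall>U\<in>subspaces_of H. \<sigma> (\<sigma> U) = U)"

definition blocks_A :: "nat \<Rightarrow> 'b set \<Rightarrow> ('b set \<Rightarrow> 'b set) \<Rightarrow> 'b set set set" where
  "blocks_A e H \<sigma> =
     {points (\<sigma> (W \<inter> H) \<union> (W - H)) |W. W \<in> subspaces_of_dim UNIV (e + 1) \<and> \<not> W \<subseteq> H}"

definition blocks_B :: "nat \<Rightarrow> 'b set \<Rightarrow> 'b set set set" where
  "blocks_B e H = {points W |W. W \<in> subspaces_of_dim H (e + 1)}"

definition blocks :: "nat \<Rightarrow> 'b set \<Rightarrow> ('b set \<Rightarrow> 'b set) \<Rightarrow> 'b set set set" where
  "blocks e H \<sigma> = blocks_A e H \<sigma> \<union> blocks_B e H"

definition design_automorphisms ::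
    "nat \<Rightarrow> 'b set \<Rightarrow> ('b set \<Rightarrow> 'b set) \<Rightarrow> ('b set \<Rightarrow> 'b set) set" where
  "design_automorphisms e H \<sigma> =
     {\<pi> \<in> Bij (points UNIV). (\<lambda>B. \<pi> ` B) ` blocks e H \<sigma> = blocks e H \<sigma>}"

definition Aut_design ::
    "nat \<Rightarrow> 'b set \<Rightarrow> ('b set \<Rightarrow> 'b set) \<Rightarrow> ('b set \<Rightarrow> 'b set) monoid" where
  "Aut_design e H \<sigma> = BijGroup (points UNIV) \<lparr>carrier := design_automorphisms e H \<sigma>\<rparr>"

definition field_automorphism :: "('a \<Rightarrow> 'a) \<Rightarrow> bool" where
  "field_automorphism \<tau> \<longleftrightarrow>
     bij \<tau> \<and> \<tau> 1 = 1 \<and>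
     (\<forall>a b. \<tau> (a + b) = \<tau> a + \<tau> b) \<and> (\<forall>a b. \<tau> (a * b) = \<tau> a * \<tau> b)"

definition semilinear :: "('b \<Rightarrow> 'b) \<Rightarrow> bool" where
  "semilinear f \<longleftrightarrow>
     (\<forall>x y. f (x + y) = f x + f y) \<and>
     (\<exists>\<tau>. field_automorphism \<tau> \<and> (\<forall>a x. f (scale a x) = scale (\<tau> a) (f x)))"

definition GammaL_stab :: "'b set \<Rightarrow> ('b \<Rightarrow> 'b) monoid" where
  "GammaL_stab H = BijGroup UNIV \<lparr>carrier := {f \<in> Bij UNIV. semilinear f \<and> f ` H = H}\<rparr>"

definition scalar_maps :: "('b \<Rightarrow> 'b) set" where
  "scalar_maps = {scale c |c. c \<noteq> 0}"

definition PGammaL_stab :: "'b set \<Rightarrow> ('b \<Rightarrow> 'b) set monoid" where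
  "PGammaL_stab H = GammaL_stab H Mod scalar_maps"

text \<open>
  The map \<open>\<phi>'\<close> on points.  It is set to \<^const>\<open>undefined\<close> outside the point set, to
  match the extensional functions in \<^const>\<open>Bij\<close>.
\<close>

definition induced_map ::
    "'b set \<Rightarrow> ('b set \<Rightarrow> 'b set) \<Rightarrow> ('b \<Rightarrow> 'b) \<Rightarrow> 'b set \<Rightarrow> 'b set" where
  "induced_map H \<sigma> \<phi> =
     (\<lambda>P\<in>points UNIV. if P \<in> points H then \<sigma> (\<phi> ` \<sigma> P) else \<phi> ` P)"

end

end

theory Submission
  imports Defs
begin

text \<open>
  Call the intersection of all blocks through two points their closure.  The closure of two points
  of \<open>H\<close> is a full line with \<open>q + 1\<close> points; two points off \<open>H\<close> give at most \<open>q\<close> points, and a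
  mixed pair only itself.  So every automorphism preserves \<open>H\<close>.  The blocks induce
  the \<open>e\<close>-dimensional flats on the affine space of points off \<open>H\<close>, and since \<open>e \<ge> 2\<close> the lines and
  planes are intersections of such flats; by the argument of the fundamental theorem of affine
  geometry the automorphism agrees off \<open>H\<close> with some \<open>\<phi>\<close>, hence with \<open>\<phi>'\<close>.  Automorphisms that
  agree off \<open>H\<close> are equal, and \<open>\<phi>'\<close> is trivial only for scalar \<open>\<phi>\<close>.
\<close>

text \<open>The block \<open>twisted (span (insert x U))\<close>, with \<open>x\<close> outside
  \<open>H\<close> and \<open>U\<close> an \<open>e\<close>-dimensional subspace of
  \<open>H\<close>, consists of the points \<open>span {x + h}\<close> with \<open>h\<close> in
  \<open>U\<close> and of the points of \<open>\<sigma> U\<close>. A polarity exchanges the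
  dimensions \<open>k\<close> and \<open>2 * e - k\<close>, so \<open>U\<close> and
  \<open>\<sigma> U\<close> both range over all \<open>e\<close>-dimensional subspaces, but in
  opposite orders: \<open>d \<in> U\<close> amounts to
  \<open>\<sigma> U \<subseteq> \<sigma> (span {d})\<close>. For \<open>d \<noteq> 0\<close> the
  latter space has dimension \<open>2 * e - 1\<close>, which exceeds \<open>e\<close> because
  \<open>e \<ge> 2\<close>, so its \<open>e\<close>-dimensional subspaces share no nonzero vector.
  Hence the closure of two points off \<open>H\<close> loses the point at infinity of their line.
  With all \<open>(e + 1)\<close>-dimensional subspaces as blocks, every such closure would be a
  full line and \<open>H\<close> could not be recognised.

  For \<open>q = 2\<close> an affine line is a mere pair of points and collinearity says nothing;
  additivity therefore rests on planes, through parallelism, and planes are available because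
  \<open>e \<ge> 2\<close>.\<close>

lemma (in projective_geometry) in_subspaces_of_dim:
  "U \<in> subspaces_of_dim W k \<longleftrightarrow> subspace U \<and> U \<subseteq> W \<and> dim U = k"
  by (auto simp: subspaces_of_dim_def subspaces_of_def)

section \<open>Linear algebra: separating a vector from a subspace\<close>

locale finite_dim_projective_geometry =
  projective_geometry scale + finite_dimensional_vector_space scale Basis
  for scale :: "'k::field \<Rightarrow> 'v::ab_group_add \<Rightarrow> 'v" and Basis
begin

lemma scale_mem_iff:
  assumes "subspace S" "c \<noteq> 0"
  shows "scale c x \<in> S \<longleftrightarrow> x \<in> S"
  using subspace_scale[OF assms(1), of x c] subspace_scale[OF assms(1), of "scale c x" "inverse c"] assms(2)
  by auto

lemma subspace_add_mem_iff:
  assumes "subspace S" "y \<in> S"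
  shows "x + y \<in> S \<longleftrightarrow> x \<in> S"
  using subspace_add[OF assms(1)] subspace_diff[OF assms(1), of "x + y" y] assms(2)
  by auto

lemma dim_insert_subspace:
  assumes "subspace U" "x \<notin> U"
  shows "dim (span (insert x U)) = dim U + 1"
  using assms by (simp add: dim_insert span_eq_iff[THEN iffD2])

text \<open>The separation tool behind every closure computation: a subspace is the intersection of
  the \<open>k\<close>-dimensional subspaces above it. \<open>S\<close> grows by vectors outside
  \<open>span (insert y S)\<close>, and \<open>k < dim K\<close> guarantees that such a vector
  exists until dimension \<open>k\<close> is reached.\<close>

lemma ex_subspace_avoiding:
  assumes S: "subspace S" "S \<subseteq> K" and K: "subspace K"
    and k: "dim S \<le> k" "k < dim K" and y: "y \<notin> S"
  shows "\<exists>U. subspace U \<and> S \<subseteq> U \<and> U \<subseteq> K \<and> dim U = k \<and> y \<notin> U"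
  using S k y
proof (induction "k - dim S" arbitrary: S)
  case 0
  then show ?case by auto
next
  case (Suc n)
  have "dim (span (insert y S)) < dim K"
    using dim_insert_subspace[of S y] Suc by auto
  then obtain z where z: "z \<in> K" "z \<notin> span (insert y S)"
    using dim_subset[of K "span (insert y S)"] by (metis leD subsetI)
  then have zS: "z \<notin> S"
    using span_superset[of "insert y S"] by auto
  let ?S = "span (insert z S)"
  have dimS: "dim ?S = dim S + 1"
    using dim_insert_subspace zS Suc by blast
  have "?S \<subseteq> K"
    using z Suc K by (simp add: span_minimal)
  moreover have "y \<notin> ?S"
    using in_span_insert[of y z S] z Suc by (metis span_eq_iff)
  ultimately have "\<exists>U. subspace U \<and> ?S \<subseteq> U \<and> U \<subseteq> K \<and> dim U = k \<and> y \<notin> U"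
    using Suc.hyps(2) Suc.prems dimS by (intro Suc.hyps(1)) auto
  then show ?case
    using span_superset[of "insert z S"] by blast
qed

section \<open>Affine flats and the bijections that preserve them\<close>

text \<open>\<open>H\<close> plays the part of an affine space here: once a vector \<open>v\<close>
  outside \<open>H\<close> is fixed, \<open>h\<close> is the coordinate of the point
  \<open>span {v + h}\<close> off \<open>H\<close>.\<close>

definition flats :: "'v set \<Rightarrow> nat \<Rightarrow> 'v set set" where
  "flats H e = {(+) w ` U |w U. w \<in> H \<and> U \<in> subspaces_of_dim H e}"

text \<open>Equality of the two families, not just an inclusion, makes the notion pass to
  inverses.\<close>

definition flat_map :: "'v set \<Rightarrow> nat \<Rightarrow> ('v \<Rightarrow> 'v) \<Rightarrow> bool" where
  "flat_map H e f \<longleftrightarrow> bij_betw f H H \<and> (\<lambda>C. f ` C) ` flats H e = flats H e"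

lemma flat_subset:
  assumes "subspace H" "C \<in> flats H e"
  shows "C \<subseteq> H"
  using assms by (auto simp: flats_def in_subspaces_of_dim intro!: subspace_add)

lemma flat_map_comp:
  assumes "flat_map H e f" "flat_map H e g"
  shows "flat_map H e (f \<circ> g)"
proof -
  have "(\<lambda>C. (f \<circ> g) ` C) ` flats H e = (\<lambda>C. f ` C) ` ((\<lambda>C. g ` C) ` flats H e)"
    by (simp add: image_image image_comp)
  with assms show ?thesis
    unfolding flat_map_def by (metis bij_betw_trans)
qed

lemma flat_map_translation:
  assumes H: "subspace H" and w: "w \<in> H"
  shows "flat_map H e (\<lambda>h. h + w)"
proof -
  have sub: "(\<lambda>C. (\<lambda>h. h + v) ` C) ` flats H e \<subseteq> flats H e" if v: "v \<in> H" for v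
  proof -
    have "(\<lambda>h. h + v) ` (+) u ` U = (+) (u + v) ` U" for u :: 'v and U
      by (auto simp: image_image algebra_simps)
    then show ?thesis
      using v subspace_add[OF H] unfolding flats_def by blast
  qed
  have "C \<in> (\<lambda>C. (\<lambda>h. h + w) ` C) ` flats H e" if "C \<in> flats H e" for C
  proof
    show "C = (\<lambda>h. h + w) ` (\<lambda>h. h + (- w)) ` C"
      by (simp add: image_image)
    show "(\<lambda>h. h + (- w)) ` C \<in> flats H e"
      using sub[of "- w"] that subspace_neg[OF H w] by blast
  qed
  moreover have "bij_betw (\<lambda>h. h + w) H H"
    using subspace_add[OF H] subspace_diff[OF H] w
    by (intro bij_betw_byWitness[where f' = "\<lambda>h. h - w"]) auto
  ultimately show ?thesis
    using sub[OF w] unfolding flat_map_def by blast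
qed

lemma flat_map_inv:
  assumes H: "subspace H" and f: "flat_map H e f"
  shows "flat_map H e (inv_into H f)"
proof -
  have bij: "bij_betw f H H" and im: "(\<lambda>C. f ` C) ` flats H e = flats H e"
    using f by (auto simp: flat_map_def)
  have "inv_into H f ` f ` C = C" if "C \<in> flats H e" for C
    using that bij flat_subset[OF H that] by (meson bij_betw_def inv_into_image_cancel)
  then have "(\<lambda>C. inv_into H f ` C) ` ((\<lambda>C. f ` C) ` flats H e) = flats H e"
    by (simp add: image_image)
  then show ?thesis
    using bij_betw_inv_into[OF bij] im by (simp add: flat_map_def)
qed

text \<open>Moves the base point \<open>w\<close> to \<open>0\<close>, so that statements about
  flats through \<open>w\<close> reduce to statements about subspaces.\<close>

lemma flat_map_centered:
  assumes H: "subspace H" and f: "flat_map H e f" and w: "w \<in> H"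
  shows "flat_map H e (\<lambda>h. f (h + w) - f w)"
proof -
  have "f w \<in> H"
    using f w by (auto simp: flat_map_def bij_betw_def)
  then have "flat_map H e ((\<lambda>h. h + (- f w)) \<circ> (f \<circ> (\<lambda>h. h + w)))"
    using H f w by (intro flat_map_comp flat_map_translation subspace_neg)
  then show ?thesis
    by (simp add: comp_def)
qed

lemma flat_through_zero:
  assumes "C \<in> flats H e" "0 \<in> C"
  shows "subspace C"
proof -
  obtain w U where C: "C = (+) w ` U" and U: "subspace U"
    using assms(1) by (auto simp: flats_def in_subspaces_of_dim)
  obtain u where "u \<in> U" "w + u = 0"
    using assms(2) C by auto
  then have "w \<in> U"
    using U subspace_neg by (metis add_eq_0_iff2)
  then have "C = U"
    using U C subspace_add_mem_iff[of U w] by (auto simp: image_iff add.commute)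
      (metis add.commute diff_add_cancel subspace_diff)
  then show ?thesis
    using U by simp
qed

text \<open>\<open>S\<close> is the intersection of the \<open>e\<close>-dimensional subspaces of
  \<open>H\<close> above it, which requires \<open>e < dim H\<close>. A bijection commutes with this
  intersection, and the image of each member is a flat through \<open>0\<close>, that is, a
  subspace.\<close>

lemma flat_map_subspace:
  assumes H: "subspace H" and f: "flat_map H e f" and f0: "f 0 = 0" and e: "e < dim H"
    and S: "subspace S" "S \<subseteq> H" "dim S \<le> e"
  shows "subspace (f ` S)"
proof -
  have bij: "bij_betw f H H" and im: "(\<lambda>C. f ` C) ` flats H e = flats H e"
    using f by (auto simp: flat_map_def)
  define \<U> where "\<U> = {U \<in> subspaces_of_dim H e. S \<subseteq> U}"
  have "f ` S = (\<Inter>U\<in>\<U>. f ` U)"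
  proof
    show "f ` S \<subseteq> (\<Inter>U\<in>\<U>. f ` U)"
      by (auto simp: \<U>_def)
    show "(\<Inter>U\<in>\<U>. f ` U) \<subseteq> f ` S"
    proof
      fix y assume y: "y \<in> (\<Inter>U\<in>\<U>. f ` U)"
      have avoid: "\<exists>U\<in>\<U>. x \<notin> U" if "x \<notin> S" for x
        using ex_subspace_avoiding[OF S(1,2) H S(3) e that]
        by (auto simp: \<U>_def in_subspaces_of_dim)
      \<comment> \<open>The family must be nonempty: an empty intersection would be the whole type,
        and \<open>y\<close> could not be pulled back to \<open>H\<close>.\<close>
      have "\<exists>x. x \<notin> S"
        using dim_subset[of UNIV S] dim_subset[of H UNIV] S(3) e by fastforce
      then obtain U where "U \<in> \<U>" using avoid by blast
      then have "U \<subseteq> H" "y \<in> f ` U"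
        using y by (auto simp: \<U>_def in_subspaces_of_dim)
      then obtain x where x: "x \<in> H" "y = f x" by blast
      have "x \<in> U" if "U \<in> \<U>" for U
      proof -
        have "U \<subseteq> H" "f x \<in> f ` U"
          using that y x by (auto simp: \<U>_def in_subspaces_of_dim)
        then show ?thesis
          using bij x by (auto simp: bij_betw_def inj_on_def)
      qed
      then show "y \<in> f ` S"
        using avoid x by blast
    qed
  qed
  moreover have "subspace (f ` U)" if "U \<in> \<U>" for U
  proof (rule flat_through_zero)
    have "U = (+) 0 ` U" by simp
    then have "U \<in> flats H e"
      using that subspace_0[OF H] unfolding flats_def \<U>_def by blast
    then show "f ` U \<in> flats H e"
      using im by blast
    show "0 \<in> f ` U"
      using f0 that subspace_0[of U] by (auto simp: \<U>_def in_subspaces_of_dim image_iff intro!: bexI[of _ 0])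
  qed
  ultimately show ?thesis
    by (auto intro!: subspace_Inter)
qed

end

section \<open>Flat-preserving bijections are semilinear\<close>

context finite_dim_projective_geometry
begin

lemma flat_map_span:
  assumes H: "subspace H" and f: "flat_map H e f" and f0: "f 0 = 0" and e: "e < dim H"
    and X: "X \<subseteq> H" "finite X" "card X \<le> e"
  shows "f ` span X = span (f ` X)"
proof
  have bij: "bij_betw f H H"
    using f by (auto simp: flat_map_def)
  have fX: "f ` X \<subseteq> H"
    using bij X by (auto simp: bij_betw_def)
  have "dim (span X) \<le> e"
    using dim_le_card[of X X] X span_superset[of X] by simp
  then have "subspace (f ` span X)"
    using span_minimal[OF X(1) H] by (intro flat_map_subspace[OF H f f0 e]) auto
  then show "span (f ` X) \<subseteq> f ` span X"
    by (simp add: image_mono span_minimal span_superset)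
  have H0: "0 \<in> H" using subspace_0[OF H] .
  have inv0: "inv_into H f 0 = 0"
    using bij f0 H0 by (metis bij_betw_inv_into_left)
  have "dim (span (f ` X)) \<le> e"
    using dim_le_card[of "f ` X" "f ` X"] X span_superset[of "f ` X"] card_image_le[of X f] by simp
  then have "subspace (inv_into H f ` span (f ` X))"
    using span_minimal[OF fX H]
    by (intro flat_map_subspace[OF H flat_map_inv[OF H f] inv0 e]) auto
  moreover have "X \<subseteq> inv_into H f ` span (f ` X)"
  proof
    fix x assume "x \<in> X"
    moreover have "inv_into H f (f x) = x"
      using bij \<open>x \<in> X\<close> X(1) by (auto simp: bij_betw_inv_into_left)
    ultimately show "x \<in> inv_into H f ` span (f ` X)"
      using span_superset[of "f ` X"] by (metis image_eqI in_mono)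
  qed
  ultimately have "span X \<subseteq> inv_into H f ` span (f ` X)"
    by (simp add: span_minimal)
  moreover have "f ` inv_into H f ` span (f ` X) = span (f ` X)"
    using bij span_minimal[OF fX H] by (simp add: bij_betw_def image_inv_into_cancel)
  ultimately show "f ` span X \<subseteq> span (f ` X)"
    by (metis image_mono)
qed

lemma flat_map_line:
  assumes H: "subspace H" and f: "flat_map H e f" and e: "1 \<le> e" "e < dim H"
    and w: "w \<in> H" and x: "x \<in> H"
  shows "(\<lambda>a. f (w + scale a x)) ` UNIV = (\<lambda>b. f w + scale b (f (w + x) - f w)) ` UNIV"
proof -
  let ?g = "\<lambda>h. f (h + w) - f w"
  have "?g ` span {x} = span {?g x}"
    using flat_map_span[OF H flat_map_centered[OF H f w], of "{x}"] e x by simp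
  then have "(\<lambda>v. f w + v) ` ?g ` span {x} = (\<lambda>v. f w + v) ` span {?g x}"
    by simp
  then show ?thesis
    by (simp add: image_image span_singleton add.commute)
qed

lemma span_singleton_not_mem:
  assumes "x \<notin> span {y}"
  shows "scale a x \<in> span {y} \<longleftrightarrow> a = 0"
  using scale_mem_iff[OF subspace_span, of a x] span_zero[of "{y}"] assms by (cases "a = 0") auto

lemma independent_coeffs:
  assumes "x \<notin> span {y}" "y \<noteq> 0"
    and eq: "scale a x + scale b y = scale c x + scale d y"
  shows "a = c" "b = d"
proof -
  have "scale (a - c) x = scale (d - b) y"
    using eq by (simp add: algebra_simps)
  then have "scale (a - c) x \<in> span {y}"
    by (auto simp: span_singleton)
  then show "a = c"
    using span_singleton_not_mem[OF assms(1)] by simp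
  with eq assms(2) show "b = d"
    by simp
qed

lemma flat_map_not_mem_span:
  assumes H: "subspace H" and f: "flat_map H e f" and f0: "f 0 = 0" and e: "1 \<le> e" "e < dim H"
    and x: "x \<in> H" and y: "y \<in> H" and xy: "x \<notin> span {y}"
  shows "f x \<notin> span {f y}"
proof
  assume "f x \<in> span {f y}"
  then obtain u where u: "u \<in> span {y}" "f x = f u"
    using flat_map_span[OF H f f0 e(2), of "{y}"] e y by auto
  moreover have "u \<in> H"
    using u y span_minimal[of "{y}" H] H by auto
  ultimately have "x = u"
    using f x by (auto simp: flat_map_def bij_betw_def inj_on_def)
  with u xy show False by simp
qed

text \<open>The two lines \<open>x + span {y}\<close> and \<open>span {y}\<close> are parallel, that is, coplanar and disjoint;
  both properties survive \<open>f\<close>.\<close>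

lemma flat_map_parallel:
  assumes H: "subspace H" and f: "flat_map H e f" and f0: "f 0 = 0" and e: "2 \<le> e" "e < dim H"
    and x: "x \<in> H" and y: "y \<in> H" "y \<noteq> 0" and xy: "x \<notin> span {y}"
  shows "\<exists>b. f (x + y) = f x + scale b (f y)"
proof -
  have inj: "inj_on f H"
    using f by (auto simp: flat_map_def bij_betw_def)
  have memH: "scale a x + scale b y \<in> H" for a b
    using x y H by (simp add: subspace_add subspace_scale)
  define z where "z = f (x + y) - f x"
  \<comment> \<open>Coplanarity: a span of two vectors is covered by \<open>flat_map_span\<close>
    because \<open>2 \<le> e\<close>.\<close>
  have "x + y \<in> span {x, y}"
    by (simp add: span_add span_base)
  then have "f (x + y) \<in> span {f x, f y}"
    using flat_map_span[OF H f f0 e(2), of "{x, y}"] x y e card_insert_le_m1[of 2 "{y}" x] by auto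
  then obtain a b where ab: "f (x + y) = scale a (f x) + scale b (f y)"
    by (auto simp: span_breakdown_eq span_singleton algebra_simps)
  then have z: "z = scale (a - 1) (f x) + scale b (f y)"
    by (simp add: z_def algebra_simps)
  have range_line: "range (\<lambda>k. f (scale k y)) = range (\<lambda>k. scale k (f y))"
    using flat_map_line[OF H f _ e(2) subspace_0[OF H] y(1)] e f0 by simp
  have "a = 1"
  proof (rule ccontr)
    assume "a \<noteq> 1"
    define c where "c = a - 1"
    have c: "c \<noteq> 0" "z = scale c (f x) + scale b (f y)"
      using \<open>a \<noteq> 1\<close> z by (auto simp: c_def)
    \<comment> \<open>The factor \<open>- inverse c\<close> cancels the \<open>f x\<close>
      component, giving a common point of the two image lines. Injectivity of \<open>f\<close> turns
      it into a common point of \<open>x + span {y}\<close> and \<open>span {y}\<close>, which are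
      disjoint.\<close>
    have "f x + scale (- inverse c) z = scale (- inverse c * b) (f y)"
      using c(1) unfolding c(2) by (simp add: scale_right_distrib)
    moreover have "f x + scale (- inverse c) z \<in> range (\<lambda>k. f x + scale k z)"
      by blast
    then have "f x + scale (- inverse c) z \<in> range (\<lambda>k. f (x + scale k y))"
      using flat_map_line[OF H f _ e(2) x y(1)] e unfolding z_def by simp
    then obtain k where "f x + scale (- inverse c) z = f (x + scale k y)"
      by auto
    moreover have "scale (- inverse c * b) (f y) \<in> range (\<lambda>k. f (scale k y))"
      unfolding range_line by blast
    then obtain d where "scale (- inverse c * b) (f y) = f (scale d y)"
      by blast
    ultimately have "f (x + scale k y) = f (scale d y)" by simp
    then have "x + scale k y = scale d y"
      using inj memH[of 1 k] memH[of 0 d] by (auto simp: inj_on_def)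
    then have "x = scale (d - k) y"
      by (simp add: algebra_simps)
    then show False
      using xy by (auto simp: span_singleton)
  qed
  then show ?thesis
    using ab by auto
qed

text \<open>Parallelism is used in both directions: \<open>f (x + y)\<close> has coefficient
  \<open>1\<close> at \<open>f x\<close>, and with the roles exchanged also at \<open>f y\<close>.
  Independence of \<open>f x\<close> and \<open>f y\<close> lets the coefficients be
  compared.\<close>

lemma flat_map_add_independent:
  assumes H: "subspace H" and f: "flat_map H e f" and f0: "f 0 = 0" and e: "2 \<le> e" "e < dim H"
    and x: "x \<in> H" and y: "y \<in> H" and xy: "x \<notin> span {y}"
  shows "f (x + y) = f x + f y"
proof (cases "y = 0")
  case False
  have "x \<noteq> 0"
    using xy span_zero by auto
  have yx: "y \<notin> span {x}"
    using in_span_insert[of y x "{}"] xy False by auto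
  obtain a b where "f (x + y) = f x + scale b (f y)" "f (y + x) = f y + scale a (f x)"
    using flat_map_parallel[OF H f f0 e x y False xy] flat_map_parallel[OF H f f0 e y x \<open>x \<noteq> 0\<close> yx] by auto
  moreover have "f x \<notin> span {f y}" "f y \<noteq> 0"
    using flat_map_not_mem_span[OF H f f0 _ e(2)] xy yx x y e span_zero by (metis One_nat_def Suc_1 Suc_leD)+
  ultimately have "b = 1"
    using independent_coeffs(2)[of "f x" "f y" 1 b a 1] by (simp add: add.commute)
  with \<open>f (x + y) = f x + scale b (f y)\<close> show ?thesis by simp
qed (use f0 in simp)

lemma ex_not_mem_line:
  assumes "2 \<le> dim H"
  shows "\<exists>z\<in>H. z \<notin> span {x}"
proof (rule ccontr)
  assume "\<not> ?thesis"
  then have "dim H \<le> dim (span {x})"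
    by (intro dim_subset) auto
  with assms show False
    by (simp split: if_splits)
qed

lemma flat_map_add:
  assumes H: "subspace H" and f: "flat_map H e f" and f0: "f 0 = 0" and e: "2 \<le> e" "e < dim H"
    and x: "x \<in> H" and y: "y \<in> H"
  shows "f (x + y) = f x + f y"
proof (cases "x \<in> span {y} \<and> x \<noteq> 0")
  case False
  then show ?thesis
    using flat_map_add_independent[OF H f f0 e x y] f0 by (cases "x = 0") auto
next
  case True
  then have y0: "y \<noteq> 0" by auto
  note add = flat_map_add_independent[OF H f f0 e]
  \<comment> \<open>For dependent \<open>x\<close> and \<open>y\<close> an auxiliary vector off
    their line lets \<open>f (z + y + x)\<close> be expanded in two ways, each using independent
    pairs only.\<close>
  obtain z where z: "z \<in> H" "z \<notin> span {y}"
    using ex_not_mem_line[of H y] e by auto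
  have zu: "z \<notin> span {u}" if "u \<in> span {y}" for u
    using that z by (meson span_minimal empty_subsetI in_mono insert_subset subspace_span)
  have "z + y \<notin> span {x}"
  proof
    assume "z + y \<in> span {x}"
    then have "z + y \<in> span {y}"
      using True by (meson span_minimal empty_subsetI in_mono insert_subset subspace_span)
    then show False
      using z subspace_add_mem_iff[OF subspace_span, of y "{y}" z] span_base[of y "{y}"] by simp
  qed
  then have "f (z + y + x) = f z + f y + f x"
    using add[of "z + y" x] add[of z y] z x y H by (simp add: subspace_add)
  moreover have "x + y \<in> span {y}"
    using True by (simp add: span_add span_base)
  then have "f (z + (x + y)) = f z + f (x + y)"
    using add[of z "x + y"] z x y H zu by (simp add: subspace_add)
  ultimately show ?thesis
    by (simp add: algebra_simps)
qed

text \<open>Lines through \<open>0\<close> go to lines through \<open>0\<close>, which gives a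
  factor \<open>t x a\<close> that may depend on \<open>x\<close>. Additivity on
  \<open>x + y\<close> forces equal factors for independent vectors, and dependent ones are compared
  through a third vector. Additivity and multiplicativity of \<open>\<tau>\<close> are then read off
  at one nonzero vector.\<close>

lemma flat_map_scale:
  assumes H: "subspace H" and f: "flat_map H e f" and f0: "f 0 = 0" and e: "2 \<le> e" "e < dim H"
    and fin: "finite (UNIV :: 'k set)"
  obtains \<tau> where "field_automorphism \<tau>" "\<And>a x. x \<in> H \<Longrightarrow> f (scale a x) = scale (\<tau> a) (f x)"
proof -
  note add = flat_map_add[OF H f f0 e]
  have inj: "inj_on f H"
    using f by (auto simp: flat_map_def bij_betw_def)
  have nz: "f x \<noteq> 0" if "x \<in> H" "x \<noteq> 0" for x
    using inj that f0 subspace_0[OF H] by (metis inj_on_def)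
  have ex_scale: "\<exists>b. f (scale a x) = scale b (f x)" if "x \<in> H" for a x
  proof -
    have "f (scale a x) \<in> range (\<lambda>k. f (scale k x))"
      by blast
    also have "\<dots> = range (\<lambda>k. scale k (f x))"
      using flat_map_line[OF H f _ e(2) subspace_0[OF H] that] e f0 by simp
    finally show ?thesis
      by blast
  qed
  define t where "t x a = (SOME b. f (scale a x) = scale b (f x))" for x a
  have t: "f (scale a x) = scale (t x a) (f x)" if "x \<in> H" for a x
    unfolding t_def using ex_scale[OF that] by (rule someI_ex)
  have ind: "t x a = t y a" if "x \<in> H" "y \<in> H" "y \<noteq> 0" "x \<notin> span {y}" for x y a
  proof -
    have "scale (t x a) (f x) + scale (t y a) (f y) = f (scale a x) + f (scale a y)"
      using t that by simp
    also have "\<dots> = f (scale a (x + y))"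
      using add that H by (simp add: scale_right_distrib subspace_scale)
    also have "\<dots> = scale (t (x + y) a) (f x) + scale (t (x + y) a) (f y)"
      using t[of "x + y"] add that H by (simp add: subspace_add scale_right_distrib)
    finally have "t x a = t (x + y) a" "t y a = t (x + y) a"
      using independent_coeffs[of "f x" "f y"] nz that flat_map_not_mem_span[OF H f f0 _ e(2)] e
      by (metis One_nat_def Suc_1 Suc_leD)+
    then show ?thesis by simp
  qed
  obtain w where w: "w \<in> H" "w \<noteq> 0"
    using ex_not_mem_line[of H 0] e by auto
  have tw: "t x a = t w a" if x: "x \<in> H" "x \<noteq> 0" for x a
  proof (cases "x \<in> span {w}")
    case True
    obtain z where z: "z \<in> H" "z \<notin> span {w}"
      using ex_not_mem_line[of H w] e by auto
    moreover have "z \<notin> span {x}"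
      using True z by (meson span_minimal empty_subsetI in_mono insert_subset subspace_span)
    ultimately show ?thesis
      using ind w x by metis
  qed (use ind x w in metis)
  define \<tau> where "\<tau> = t w"
  \<comment> \<open>The value \<open>t 0 a\<close> is an arbitrary choice, but at
    \<open>x = 0\<close> both sides vanish.\<close>
  have \<tau>: "f (scale a x) = scale (\<tau> a) (f x)" if "x \<in> H" for a x
    using t[OF that] tw[OF that] f0 by (cases "x = 0") (auto simp: \<tau>_def)
  have fw: "f w \<noteq> 0"
    using nz w by simp
  have "\<tau> 1 = 1"
    using \<tau>[OF w(1), of 1] fw by (metis scale_one scale_right_imp_eq)
  moreover have "\<tau> (a + b) = \<tau> a + \<tau> b" for a b
  proof -
    have "scale (\<tau> (a + b)) (f w) = f (scale a w + scale b w)"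
      using \<tau>[OF w(1), of "a + b"] by (simp add: scale_left_distrib)
    also have "\<dots> = scale (\<tau> a + \<tau> b) (f w)"
      using \<tau>[OF w(1)] add w H by (simp add: scale_left_distrib subspace_scale)
    finally show ?thesis
      using fw by simp
  qed
  moreover have "\<tau> (a * b) = \<tau> a * \<tau> b" for a b
  proof -
    have "scale (\<tau> (a * b)) (f w) = f (scale a (scale b w))"
      using \<tau>[OF w(1), of "a * b"] by simp
    also have "\<dots> = scale (\<tau> a * \<tau> b) (f w)"
      using \<tau>[OF w(1)] \<tau>[of "scale b w"] w H by (simp add: subspace_scale)
    finally show ?thesis
      using fw by simp
  qed
  \<comment> \<open>Surjectivity comes from injectivity because the field is finite.\<close>
  moreover have "bij \<tau>"
  proof -
    have "inj \<tau>"
    proof (rule injI)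
      fix a b assume "\<tau> a = \<tau> b"
      then have "f (scale a w) = f (scale b w)"
        using \<tau>[OF w(1)] by simp
      then have "scale a w = scale b w"
        using inj_onD[OF inj] w H by (meson subspace_scale)
      then show "a = b"
        using w by simp
    qed
    then show ?thesis
      using fin by (simp add: bij_def finite_UNIV_inj_surj)
  qed
  ultimately have "field_automorphism \<tau>"
    by (simp add: field_automorphism_def)
  then show thesis
    using that \<tau> by blast
qed

end

section \<open>The semilinear group\<close>

context finite_dim_projective_geometry
begin

lemma field_automorphism_comp:
  assumes "field_automorphism \<tau>" "field_automorphism \<rho>"
  shows "field_automorphism (\<tau> \<circ> \<rho>)"
  using assms by (auto simp: field_automorphism_def intro: bij_comp)

lemma field_automorphism_inv:
  assumes \<tau>: "field_automorphism \<tau>"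
  shows "field_automorphism (inv_into UNIV \<tau>)"
proof -
  have bij: "bij \<tau>" using \<tau> by (simp add: field_automorphism_def)
  have inv_eq: "inv_into UNIV \<tau> x = y" if "x = \<tau> y" for x y
    using bij that by (simp add: bij_is_inj)
  have inv: "\<tau> (inv_into UNIV \<tau> x) = x" for x
    using bij by (simp add: bij_is_surj surj_f_inv_f)
  have "inv_into UNIV \<tau> 1 = 1"
    "inv_into UNIV \<tau> (a + b) = inv_into UNIV \<tau> a + inv_into UNIV \<tau> b"
    "inv_into UNIV \<tau> (a * b) = inv_into UNIV \<tau> a * inv_into UNIV \<tau> b" for a b
    using \<tau> by (auto intro!: inv_eq simp: field_automorphism_def inv)
  then show ?thesis
    using bij by (simp add: field_automorphism_def bij_imp_bij_inv)
qed

lemma semilinear_comp: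
  assumes "semilinear f" "semilinear g"
  shows "semilinear (f \<circ> g)"
proof -
  obtain \<tau> \<rho> where "field_automorphism \<tau>" "\<And>a x. f (scale a x) = scale (\<tau> a) (f x)"
    "field_automorphism \<rho>" "\<And>a x. g (scale a x) = scale (\<rho> a) (g x)"
    using assms by (auto simp: semilinear_def)
  then have "field_automorphism (\<tau> \<circ> \<rho>) \<and> (\<forall>a x. (f \<circ> g) (scale a x) = scale ((\<tau> \<circ> \<rho>) a) ((f \<circ> g) x))"
    by (simp add: field_automorphism_comp)
  then show ?thesis
    using assms unfolding semilinear_def by (auto simp: comp_def)
qed

lemma semilinear_inv:
  assumes f: "semilinear f" "bij f"
  shows "semilinear (inv_into UNIV f)"
proof -
  have inv_eq: "inv_into UNIV f x = y" if "x = f y" for x y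
    using f that by (simp add: bij_is_inj)
  have inv: "f (inv_into UNIV f x) = x" for x
    using f by (simp add: bij_is_surj surj_f_inv_f)
  obtain \<tau> where \<tau>: "field_automorphism \<tau>" "\<And>a x. f (scale a x) = scale (\<tau> a) (f x)"
    using f by (auto simp: semilinear_def)
  have "\<tau> (inv_into UNIV \<tau> a) = a" for a
    using \<tau>(1) by (simp add: field_automorphism_def bij_is_surj surj_f_inv_f)
  then have "inv_into UNIV f (scale a x) = scale (inv_into UNIV \<tau> a) (inv_into UNIV f x)" for a x
    by (intro inv_eq) (simp add: \<tau>(2) inv)
  moreover have "inv_into UNIV f (x + y) = inv_into UNIV f x + inv_into UNIV f y" for x y
    using f(1) by (intro inv_eq) (simp add: semilinear_def inv)
  ultimately show ?thesis
    using field_automorphism_inv[OF \<tau>(1)] unfolding semilinear_def by blast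
qed

lemma semilinear_image_span:
  assumes f: "semilinear f"
  shows "f ` span X = span (f ` X)"
proof -
  obtain \<tau> where \<tau>: "field_automorphism \<tau>" "\<And>a x. f (scale a x) = scale (\<tau> a) (f x)"
    using f by (auto simp: semilinear_def)
  have add: "f (x + y) = f x + f y" for x y
    using f by (simp add: semilinear_def)
  have f0: "f 0 = 0"
    using add[of 0 0] by simp
  have "subspace {v. f v \<in> span (f ` X)}"
    by (auto intro!: subspaceI simp: add \<tau>(2) f0 span_zero span_add span_scale)
  moreover have "X \<subseteq> {v. f v \<in> span (f ` X)}"
    by (auto intro: span_base)
  ultimately have "span X \<subseteq> {v. f v \<in> span (f ` X)}"
    by (rule span_minimal[rotated])
  moreover have "subspace (f ` span X)"
  proof (rule subspaceI)
    show "0 \<in> f ` span X"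
      using f0 span_zero by (metis image_eqI)
    show "x + y \<in> f ` span X" if "x \<in> f ` span X" "y \<in> f ` span X" for x y
      using that by (auto simp: add[symmetric] intro!: imageI span_add)
    show "scale a x \<in> f ` span X" if x: "x \<in> f ` span X" for a x
    proof -
      obtain y where y: "y \<in> span X" "x = f y"
        using x by blast
      \<comment> \<open>Surjectivity of \<open>\<tau>\<close> is what makes the image closed under
        all scalars.\<close>
      obtain b where "a = \<tau> b"
        using \<tau>(1) by (metis field_automorphism_def bij_pointE)
      then have "scale a x = f (scale b y)"
        by (simp add: \<tau>(2) y(2))
      then show ?thesis
        using y(1) span_scale by blast
    qed
  qed
  ultimately show ?thesis
    using span_minimal[of "f ` X" "f ` span X"] span_superset[of X] by blast
qed

lemma semilinear_image_subspace:
  assumes "semilinear f" "subspace U"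
  shows "subspace (f ` U)"
proof -
  have "f ` span U = f ` U"
    using assms(2) by (simp add: span_eq_iff[THEN iffD2])
  then show ?thesis
    using subspace_span[of "f ` U"] unfolding semilinear_image_span[OF assms(1)] by simp
qed

text \<open>The image of a basis spans the image, so a semilinear map cannot raise the dimension;
  the inverse is semilinear too and gives the reverse inequality.\<close>

lemma dim_semilinear_image:
  assumes f: "semilinear f" "bij f"
  shows "dim (f ` U) = dim U"
proof -
  have le: "dim (g ` W) \<le> dim W" if g: "semilinear g" for g W
  proof -
    obtain B where B: "B \<subseteq> W" "independent B" "W \<subseteq> span B" "card B = dim W"
      using basis_exists by blast
    have fin: "finite B"
      using B finiteI_independent by blast
    have "g ` W \<subseteq> span (g ` B)"
      using B(3) semilinear_image_span[OF g] by blast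
    then have "dim (g ` W) \<le> card (g ` B)"
      using fin by (intro dim_le_card) auto
    also have "\<dots> \<le> dim W"
      using card_image_le[OF fin] B(4) by simp
    finally show ?thesis .
  qed
  have "inv_into UNIV f ` f ` U = U"
    using f(2) by (simp add: bij_is_inj)
  then show ?thesis
    using le[OF f(1), of U] le[OF semilinear_inv[OF f], of "f ` U"] by simp
qed

lemma GammaL_stab_iff: "\<phi> \<in> carrier (GammaL_stab H) \<longleftrightarrow> bij \<phi> \<and> semilinear \<phi> \<and> \<phi> ` H = H"
  by (auto simp: GammaL_stab_def Bij_def)

lemma group_GammaL_stab: "group (GammaL_stab H)"
proof -
  have "subgroup {f \<in> Bij UNIV. semilinear f \<and> f ` H = H} (BijGroup UNIV)"
  proof (rule subgroup.intro)
    fix \<phi> \<psi>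
    assume *: "\<phi> \<in> {f \<in> Bij UNIV. semilinear f \<and> f ` H = H}"
      "\<psi> \<in> {f \<in> Bij UNIV. semilinear f \<and> f ` H = H}"
    then have "semilinear (\<phi> \<circ> \<psi>)" "\<phi> \<circ> \<psi> \<in> Bij UNIV"
      by (simp_all add: semilinear_comp Bij_def bij_comp)
    moreover have "(\<phi> \<circ> \<psi>) ` H = H"
      using * unfolding image_comp[symmetric] by simp
    ultimately show "\<phi> \<otimes>\<^bsub>BijGroup UNIV\<^esub> \<psi> \<in> {f \<in> Bij UNIV. semilinear f \<and> f ` H = H}"
      using * by (simp add: BijGroup_def compose_def comp_def restrict_def)
  next
    have "semilinear (\<lambda>x. x)"
      by (auto simp: semilinear_def field_automorphism_def intro!: exI[of _ "\<lambda>x. x"] bij_id[unfolded id_def])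
    then show "\<one>\<^bsub>BijGroup UNIV\<^esub> \<in> {f \<in> Bij UNIV. semilinear f \<and> f ` H = H}"
      using id_Bij[of UNIV] by (simp add: BijGroup_def restrict_def)
  next
    fix \<phi> assume \<phi>: "\<phi> \<in> {f \<in> Bij UNIV. semilinear f \<and> f ` H = H}"
    then have bij: "bij \<phi>" by (simp add: Bij_def)
    then have "inv_into UNIV \<phi> ` \<phi> ` H = H"
      by (simp add: bij_is_inj image_inv_f_f)
    then have "inv_into UNIV \<phi> ` H = H"
      using \<phi> by simp
    then show "inv\<^bsub>BijGroup UNIV\<^esub> \<phi> \<in> {f \<in> Bij UNIV. semilinear f \<and> f ` H = H}"
      using \<phi> bij semilinear_inv[of \<phi>] by (simp add: inv_BijGroup restrict_def) (simp add: Bij_def bij_imp_bij_inv)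
  qed (auto simp: BijGroup_def)
  then show ?thesis
    unfolding GammaL_stab_def by (rule subgroup.subgroup_is_group[OF _ group_BijGroup])
qed

lemma mult_GammaL_stab:
  assumes "\<phi> \<in> carrier (GammaL_stab H)" "\<psi> \<in> carrier (GammaL_stab H)"
  shows "\<phi> \<otimes>\<^bsub>GammaL_stab H\<^esub> \<psi> = \<phi> \<circ> \<psi>"
  using assms by (simp add: GammaL_stab_def BijGroup_def compose_def comp_def restrict_def)

lemma inv_in_GammaL_stab:
  assumes "\<phi> \<in> carrier (GammaL_stab H)"
  shows "inv_into UNIV \<phi> \<in> carrier (GammaL_stab H)"
proof -
  have \<phi>: "bij \<phi>" "semilinear \<phi>" "\<phi> ` H = H"
    using assms by (simp_all add: GammaL_stab_iff)
  have "inv_into UNIV \<phi> ` \<phi> ` H = H"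
    using \<phi>(1) by (simp add: bij_is_inj image_inv_f_f)
  then show ?thesis
    using \<phi> semilinear_inv[of \<phi>] by (simp add: GammaL_stab_iff bij_imp_bij_inv)
qed

end

section \<open>Polarities and blocks\<close>

context finite_dim_projective_geometry
begin

lemma dim_less_subspaces:
  assumes "subspace U" "subspace W" "U \<subset> W"
  shows "dim U < dim W"
  using dim_psubset[of U W] assms by (simp add: span_eq_iff[THEN iffD2])

lemma span_singleton_subset:
  assumes "subspace S"
  shows "span {x} \<subseteq> S \<longleftrightarrow> x \<in> S"
  using span_minimal[of "{x}" S] assms span_base[of x "{x}"] by auto

lemma span_singleton_eq:
  assumes "x \<noteq> 0" "y \<noteq> 0"
  shows "span {x} = span {y} \<longleftrightarrow> x \<in> span {y}"
proof
  assume "x \<in> span {y}"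
  then have "span {x} \<subseteq> span {y}"
    by (simp add: span_singleton_subset)
  then show "span {x} = span {y}"
    using assms by (intro subspace_dim_equal) auto
qed (auto intro: span_base)

lemma points_iff: "P \<in> points W \<longleftrightarrow> (\<exists>x. x \<noteq> 0 \<and> P = span {x} \<and> span {x} \<subseteq> W)"
proof
  assume P: "P \<in> points W"
  then obtain x where x: "x \<in> P" "x \<noteq> 0"
    using dim_eq_0[of P] by (auto simp: points_def)
  then have "span {x} = P"
    using P by (intro subspace_dim_equal) (auto simp: points_def span_singleton_subset)
  with P x show "\<exists>x. x \<noteq> 0 \<and> P = span {x} \<and> span {x} \<subseteq> W"
    by (auto simp: points_def)
qed (auto simp: points_def)

lemma span_singleton_in_points:
  assumes "subspace W" "x \<noteq> 0"
  shows "span {x} \<in> points W \<longleftrightarrow> x \<in> W"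
  using assms by (simp add: points_def span_singleton_subset)

end

locale twisted_design = finite_dim_projective_geometry scale Basis
  for scale :: "'k::{field,finite} \<Rightarrow> 'v::ab_group_add \<Rightarrow> 'v" and Basis +
  fixes H :: "'v set" and e :: nat and \<sigma> :: "'v set \<Rightarrow> 'v set"
  assumes e_ge_2: "2 \<le> e"
    and dim_V: "dim (UNIV :: 'v set) = 2 * e + 1"
    and subspace_H: "subspace H"
    and dim_H: "dim H = 2 * e"
    and polarity: "polarity H \<sigma>"
begin

lemma polar_subspace:
  assumes "subspace U" "U \<subseteq> H"
  shows "subspace (\<sigma> U)" "\<sigma> U \<subseteq> H"
proof -
  have "\<sigma> U \<in> subspaces_of H"
    using polarity assms by (auto simp: polarity_def bij_betw_def subspaces_of_def)
  then show "subspace (\<sigma> U)" "\<sigma> U \<subseteq> H"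
    by (auto simp: subspaces_of_def)
qed

lemma polar_polar:
  assumes "subspace U" "U \<subseteq> H"
  shows "\<sigma> (\<sigma> U) = U"
  using polarity assms by (auto simp: polarity_def subspaces_of_def)

lemma polar_antimono:
  assumes "subspace W" "W \<subseteq> H" "subspace U" "U \<subseteq> W"
  shows "\<sigma> W \<subseteq> \<sigma> U"
  using polarity assms by (auto simp: polarity_def subspaces_of_def)

lemma polar_subset_iff:
  assumes "subspace U" "U \<subseteq> H" "subspace W" "W \<subseteq> H"
  shows "\<sigma> W \<subseteq> \<sigma> U \<longleftrightarrow> U \<subseteq> W"
  using polar_antimono[of W U] polar_antimono[of "\<sigma> U" "\<sigma> W"] assms
  by (auto simp: polar_polar polar_subspace)

lemma polar_swap:
  assumes "subspace U" "U \<subseteq> H" "subspace W" "W \<subseteq> H"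
  shows "U \<subseteq> \<sigma> W \<longleftrightarrow> W \<subseteq> \<sigma> U"
  using polar_subset_iff[of "\<sigma> W" U] polar_subset_iff[of W "\<sigma> U"] assms
  by (auto simp: polar_polar polar_subspace)

lemma dim_polar_less:
  assumes "subspace U" "subspace W" "W \<subseteq> H" "U \<subset> W"
  shows "dim (\<sigma> W) < dim (\<sigma> U)"
  using assms polar_subset_iff[of U W] polar_subset_iff[of W U]
  by (intro dim_less_subspaces polar_subspace) auto

text \<open>No bilinear or sesquilinear form is at hand, only strict order reversal. Descending from
  \<open>U\<close> one dimension at a time raises \<open>dim (\<sigma> U)\<close> by at least one
  per step, and it never exceeds \<open>2 * e\<close>; ascending to \<open>H\<close> gives the
  opposite bound. In particular \<open>\<sigma>\<close> permutes the \<open>e\<close>-dimensional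
  subspaces.\<close>

lemma dim_polar:
  assumes U: "subspace U" "U \<subseteq> H"
  shows "dim (\<sigma> U) + dim U = 2 * e"
proof (rule antisym)
  show "dim (\<sigma> U) + dim U \<le> 2 * e"
    using U
  proof (induction "dim U" arbitrary: U rule: less_induct)
    case less
    show ?case
    proof (cases "U \<subseteq> {0}")
      case True
      then have "dim U = 0" by simp
      then show ?thesis
        using dim_subset[OF polar_subspace(2)[OF less.prems]] dim_H by linarith
    next
      case False
      then obtain y where "y \<in> U" "y \<noteq> 0" by blast
      then have dimU: "dim U \<noteq> 0"
        using False by simp
      have "0 \<in> U" "dim U - 1 < dim U"
        using less.prems(1) subspace_0 dimU by (blast, linarith)
      then obtain T where T: "subspace T" "T \<subseteq> U" "dim T = dim U - 1" "y \<notin> T"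
        using ex_subspace_avoiding[of "{0}" U "dim U - 1" y] less.prems(1) \<open>y \<noteq> 0\<close> by auto
      then have "dim (\<sigma> U) < dim (\<sigma> T)"
        using less.prems \<open>y \<in> U\<close> by (intro dim_polar_less) auto
      moreover have "dim (\<sigma> T) + dim T \<le> 2 * e"
        using T less.prems \<open>dim U - 1 < dim U\<close> by (intro less.hyps) simp_all
      ultimately show ?thesis
        using T dimU by linarith
    qed
  qed
  show "2 * e \<le> dim (\<sigma> U) + dim U"
    using U
  proof (induction "2 * e - dim U" arbitrary: U rule: less_induct)
    case less
    show ?case
    proof (cases "U = H")
      case False
      then obtain x where x: "x \<in> H" "x \<notin> U"
        using less.prems by auto
      let ?T = "span (insert x U)"
      have T: "?T \<subseteq> H" "dim ?T = dim U + 1" "U \<subset> ?T"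
        using x less.prems subspace_H dim_insert_subspace[of U x] span_superset[of "insert x U"]
        by (auto simp: span_minimal)
      then have "dim (\<sigma> ?T) < dim (\<sigma> U)"
        using less.prems by (intro dim_polar_less) auto
      moreover have "dim ?T \<le> 2 * e"
        using dim_subset[OF T(1)] dim_H by simp
      then have "2 * e \<le> dim (\<sigma> ?T) + dim ?T"
        using T by (intro less.hyps) auto
      ultimately show ?thesis
        using T by linarith
    qed (simp add: dim_H)
  qed
qed

section \<open>Blocks off the hyperplane as joins of a vector with an \<open>e\<close>-dimensional
  subspace\<close>

text \<open>The space is the direct sum of \<open>H\<close> and the line of \<open>x\<close>;
  \<open>a\<close> is the coordinate of \<open>v\<close> along \<open>x\<close>.\<close>

lemma hyperplane_coordinate:
  assumes "x \<notin> H"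
  shows "\<exists>a. v - scale a x \<in> H"
proof -
  have "span (insert x H) = UNIV"
    using dim_insert_subspace[OF subspace_H assms] dim_V dim_H
    by (intro subspace_dim_equal) auto
  then have "v \<in> span (insert x H)" by simp
  then show ?thesis
    using subspace_H by (simp add: span_breakdown_eq span_eq_iff[THEN iffD2])
qed

text \<open>Parametrises the subspaces behind \<open>blocks_A\<close> that contain \<open>x\<close>
  by their trace \<open>U\<close> on \<open>H\<close>.\<close>

lemma join_off_hyperplane:
  assumes x: "x \<notin> H" and U: "U \<in> subspaces_of_dim H e"
  shows "span (insert x U) \<inter> H = U" "span (insert x U) \<in> subspaces_of_dim UNIV (e + 1)"
    "\<not> span (insert x U) \<subseteq> H" "y - x \<in> H \<Longrightarrow> y \<in> span (insert x U) \<longleftrightarrow> y - x \<in> U"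
proof -
  have U: "subspace U" "U \<subseteq> H" "dim U = e"
    using U by (auto simp: in_subspaces_of_dim)
  have xW: "x \<in> span (insert x U)" and UW: "U \<subseteq> span (insert x U)"
    using span_superset[of "insert x U"] by auto
  have "v \<in> U" if v: "v \<in> span (insert x U)" "v \<in> H" for v
  proof -
    obtain k where k: "v - scale k x \<in> U"
      using v(1) U by (auto simp: span_breakdown_eq span_eq_iff[THEN iffD2])
    then have "v - (v - scale k x) \<in> H"
      using U v subspace_H by (blast intro: subspace_diff)
    then have "k = 0"
      using x scale_mem_iff[OF subspace_H, of k x] by auto
    with k show ?thesis by simp
  qed
  then show W: "span (insert x U) \<inter> H = U"
    using UW U by auto
  show "span (insert x U) \<in> subspaces_of_dim UNIV (e + 1)"
    using dim_insert_subspace[of U x] U x by (auto simp: in_subspaces_of_dim)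
  show "\<not> span (insert x U) \<subseteq> H"
    using xW x by auto
  show "y \<in> span (insert x U) \<longleftrightarrow> y - x \<in> U" if "y - x \<in> H"
    using subspace_add_mem_iff[OF subspace_span xW, of "y - x"] W that by auto
qed

lemma dim_inter_hyperplane:
  assumes W: "W \<in> subspaces_of_dim UNIV (e + 1)" "\<not> W \<subseteq> H"
  shows "W \<inter> H \<in> subspaces_of_dim H e"
proof -
  have W': "subspace W" "dim W = e + 1" using W by (auto simp: in_subspaces_of_dim)
  obtain x where x: "x \<in> W" "x \<notin> H" using W by auto
  have sub: "subspace (W \<inter> H)"
    using W' subspace_H by (simp add: subspace_inter)
  have "W \<subseteq> span (insert x (W \<inter> H))"
  proof
    fix v assume v: "v \<in> W"
    obtain a where "v - scale a x \<in> H"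
      using hyperplane_coordinate[OF x(2)] by blast
    moreover have "v - scale a x \<in> W"
      using v x W' by (simp add: subspace_diff subspace_scale)
    ultimately show "v \<in> span (insert x (W \<inter> H))"
      using sub by (auto simp: span_breakdown_eq span_eq_iff[THEN iffD2])
  qed
  then have "W = span (insert x (W \<inter> H))"
    using x W' by (intro antisym span_minimal) auto
  then have "dim W = dim (W \<inter> H) + 1"
    using dim_insert_subspace[OF sub, of x] x by simp
  then show ?thesis
    using W' sub by (auto simp: in_subspaces_of_dim)
qed

text \<open>With \<open>x\<close> in the subspace but off \<open>H\<close>, each of its vectors
  \<open>w\<close> in \<open>H\<close> is the difference of the two vectors \<open>w + x\<close> and
  \<open>x\<close> off \<open>H\<close>.\<close>

lemma off_hyperplane_determines:
  assumes "subspace W\<^sub>1" "subspace W\<^sub>2" "\<not> W\<^sub>1 \<subseteq> H" "W\<^sub>1 - H = W\<^sub>2 - H"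
  shows "W\<^sub>1 = W\<^sub>2"
proof -
  have sub: "W \<subseteq> W'" if W: "subspace W" "subspace W'" "\<not> W \<subseteq> H" "W - H = W' - H" for W W'
  proof
    fix w assume w: "w \<in> W"
    obtain x where x: "x \<in> W" "x \<notin> H" using W by auto
    show "w \<in> W'"
    proof (cases "w \<in> H")
      case True
      then have "w + x \<in> W - H"
        using w x W subspace_add_mem_iff[OF subspace_H, of w x] subspace_add[of W w x]
          subspace_add_mem_iff[OF subspace_H True, of x] by (auto simp: add.commute)
      then have "w + x \<in> W'" "x \<in> W'"
        using W x by auto
      then show ?thesis
        using subspace_add_mem_iff[OF W(2)] by blast
    qed (use w W in auto)
  qed
  then show ?thesis
    using assms by (metis Diff_eq_empty_iff antisym)
qed

definition twisted :: "'v set \<Rightarrow> 'v set set" where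
  "twisted W = points (\<sigma> (W \<inter> H) \<union> (W - H))"

text \<open>The union in \<open>twisted\<close> is not a subspace in general, but a point lies
  inside \<open>H\<close> or meets it in \<open>0\<close> only, so a generator decides
  membership.\<close>

lemma twisted_mem:
  assumes W: "subspace W" and x: "x \<noteq> 0"
  shows "span {x} \<in> twisted W \<longleftrightarrow> (if x \<in> H then x \<in> \<sigma> (W \<inter> H) else x \<in> W)"
proof -
  have sub: "subspace (\<sigma> (W \<inter> H))" "\<sigma> (W \<inter> H) \<subseteq> H"
    using polar_subspace[OF subspace_inter[OF W subspace_H]] by simp_all
  have x0: "x \<in> span {x}" by (simp add: span_base)
  show ?thesis
  proof (cases "x \<in> H")
    case True
    then show ?thesis
      using x x0 sub span_singleton_subset[OF sub(1), of x]
      by (auto simp: twisted_def points_def)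
  next
    case False
    \<comment> \<open>The zero vector of the point is missing from \<open>W - H\<close>; it is
      supplied by \<open>\<sigma> (W \<inter> H)\<close>.\<close>
    have "span {x} \<subseteq> \<sigma> (W \<inter> H) \<union> (W - H)" if "x \<in> W"
    proof
      fix y assume "y \<in> span {x}"
      then obtain k where "y = scale k x" by (auto simp: span_singleton)
      then show "y \<in> \<sigma> (W \<inter> H) \<union> (W - H)"
        using scale_mem_iff[OF subspace_H, of k x] that W False subspace_0[OF sub(1)]
        by (cases "k = 0") (auto intro: subspace_scale)
    qed
    then show ?thesis
      using False x x0 sub by (auto simp: twisted_def points_def)
  qed
qed

lemma blocks_eq:
  "blocks e H \<sigma> = twisted ` {W \<in> subspaces_of_dim UNIV (e + 1). \<not> W \<subseteq> H} \<union> points ` subspaces_of_dim H (e + 1)"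
  by (auto simp: blocks_def blocks_A_def blocks_B_def twisted_def)

lemma twisted_in_blocks:
  assumes "W \<in> subspaces_of_dim UNIV (e + 1)" "\<not> W \<subseteq> H"
  shows "twisted W \<in> blocks e H \<sigma>"
  using assms by (auto simp: blocks_eq)

lemma blocks_subset_points: "B \<in> blocks e H \<sigma> \<Longrightarrow> B \<subseteq> points UNIV"
  by (auto simp: blocks_eq twisted_def points_def)

lemma block_off_hyperplane:
  assumes "B \<in> blocks e H \<sigma>" "span {x} \<in> B" "x \<notin> H"
  obtains W where "W \<in> subspaces_of_dim UNIV (e + 1)" "\<not> W \<subseteq> H" "B = twisted W"
proof -
  have "B \<notin> points ` subspaces_of_dim H (e + 1)"
    using assms(2,3) by (auto simp: points_def in_subspaces_of_dim span_singleton_subset)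
  then show thesis
    using assms(1) that by (auto simp: blocks_eq)
qed

end

section \<open>Automorphisms preserve the hyperplane\<close>

context twisted_design
begin

text \<open>Together with \<open>affine_point\<close> this makes
  \<open>h \<mapsto> span {x + h}\<close> a bijection from \<open>H\<close> onto the points off
  \<open>H\<close>.\<close>

lemma span_eq_affine_iff:
  assumes x: "x \<notin> H" and h: "h \<in> H" "k \<in> H"
  shows "span {x + h} = span {x + k} \<longleftrightarrow> h = k"
proof
  assume "span {x + h} = span {x + k}"
  then have "x + h \<in> span {x + k}"
    using span_base[of "x + h" "{x + h}"] by simp
  then obtain a where a: "x + h = scale a (x + k)"
    by (auto simp: span_singleton)
  then have "scale (1 - a) x = scale a k - h"
    by (simp add: algebra_simps)
  moreover have "scale a k - h \<in> H"
    using h subspace_H by (simp add: subspace_diff subspace_scale)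
  ultimately have "a = 1"
    using scale_mem_iff[OF subspace_H, of "1 - a" x] x by auto
  with a show "h = k" by simp
qed simp

lemma add_not_mem_hyperplane: "x \<notin> H \<Longrightarrow> h \<in> H \<Longrightarrow> x + h \<notin> H"
  using subspace_add_mem_iff[OF subspace_H] by blast

lemma not_mem_hyperplane_nonzero: "x \<notin> H \<Longrightarrow> x \<noteq> 0"
  using subspace_0[OF subspace_H] by auto

lemma affine_point:
  assumes x: "x \<notin> H" and P: "P \<in> points UNIV" "P \<notin> points H"
  obtains h where "h \<in> H" "P = span {x + h}"
proof -
  obtain z where z: "z \<noteq> 0" "P = span {z}"
    using P(1) by (auto simp: points_iff)
  then have zH: "z \<notin> H"
    using P(2) span_singleton_in_points[OF subspace_H] by auto
  obtain a where a: "x - scale a z \<in> H"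
    using hyperplane_coordinate[OF zH] by blast
  then have a0: "a \<noteq> 0"
    using x by auto
  have "P = span {scale a z}"
    using z a0 span_singleton_eq[of "scale a z" z] by (auto simp: span_singleton)
  moreover have "scale a z - x \<in> H"
    using subspace_neg[OF subspace_H a] by simp
  ultimately show thesis
    using that[of "scale a z - x"] by simp
qed

lemma ex_dim_subspace_avoiding_nonzero:
  assumes "subspace K" "k < dim K" "r \<noteq> 0"
  shows "\<exists>U. subspace U \<and> U \<subseteq> K \<and> dim U = k \<and> r \<notin> U"
  using ex_subspace_avoiding[of "{0}" K k r] assms subspace_0[of K] by auto

definition design_closure :: "'v set \<Rightarrow> 'v set \<Rightarrow> 'v set set" where
  "design_closure P Q = {R \<in> points UNIV. \<forall>B\<in>blocks e H \<sigma>. P \<in> B \<and> Q \<in> B \<longrightarrow> R \<in> B}"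

lemma design_closure_commute: "design_closure P Q = design_closure Q P"
  by (auto simp: design_closure_def)

lemma design_closure_twisted:
  assumes "R \<in> design_closure P Q" "x \<notin> H" "U \<in> subspaces_of_dim H e"
    and "P \<in> twisted (span (insert x U))" "Q \<in> twisted (span (insert x U))"
  shows "R \<in> twisted (span (insert x U))"
  using assms twisted_in_blocks[of "span (insert x U)"] join_off_hyperplane[OF assms(2,3)]
  by (auto simp: design_closure_def)

lemma twisted_join_mem:
  assumes "x \<notin> H" "U \<in> subspaces_of_dim H e"
  shows "h \<in> H \<Longrightarrow> span {x + h} \<in> twisted (span (insert x U)) \<longleftrightarrow> h \<in> U"
    and "r \<in> H \<Longrightarrow> r \<noteq> 0 \<Longrightarrow> span {r} \<in> twisted (span (insert x U)) \<longleftrightarrow> r \<in> \<sigma> U"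
  using twisted_mem[OF subspace_span] join_off_hyperplane[OF assms]
    add_not_mem_hyperplane[OF assms(1)] not_mem_hyperplane_nonzero by auto

text \<open>The blocks through both points come from the \<open>U\<close> containing
  \<open>d\<close>. A point off \<open>H\<close> outside the affine line is excluded by a
  \<open>U\<close> above \<open>span {d}\<close> that misses it; a point of \<open>H\<close> is
  excluded since \<open>\<sigma> U\<close> can be any \<open>e\<close>-dimensional subspace of
  \<open>\<sigma> (span {d})\<close>.\<close>

lemma design_closure_affine:
  assumes x: "x \<notin> H" and d: "d \<in> H"
  shows "design_closure (span {x}) (span {x + d}) \<subseteq> range (\<lambda>a. span {x + scale a d})"
proof
  fix R assume R: "R \<in> design_closure (span {x}) (span {x + d})"
  have dim_d: "dim (span {d}) \<le> 1" "span {d} \<subseteq> H"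
    using d subspace_H by (auto simp: span_singleton_subset)
  have xU: "span {x} \<in> twisted (span (insert x U))" if "U \<in> subspaces_of_dim H e" for U
    using twisted_join_mem(1)[OF x that subspace_0[OF subspace_H]] that
    by (auto simp: in_subspaces_of_dim subspace_0)
  show "R \<in> range (\<lambda>a. span {x + scale a d})"
  proof (cases "R \<in> points H")
    case False
    moreover have "R \<in> points UNIV" using R by (simp add: design_closure_def)
    ultimately obtain h where h: "h \<in> H" "R = span {x + h}"
      using affine_point[OF x] by blast
    have "h \<in> span {d}"
    proof (rule ccontr)
      assume "h \<notin> span {d}"
      then obtain U where U: "U \<in> subspaces_of_dim H e" "span {d} \<subseteq> U" "h \<notin> U"
        using ex_subspace_avoiding[OF subspace_span dim_d(2) subspace_H, of e h] dim_d e_ge_2 dim_H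
        by (auto simp: in_subspaces_of_dim)
      then have "d \<in> U" by (auto intro: span_base)
      then have "R \<in> twisted (span (insert x U))"
        using design_closure_twisted[OF R x U(1)] xU[OF U(1)] twisted_join_mem(1)[OF x U(1) d] by blast
      then show False
        using twisted_join_mem(1)[OF x U(1) h(1)] h(2) U(3) by simp
    qed
    then show ?thesis
      using h by (auto simp: span_singleton)
  next
    case True
    then obtain r where r: "r \<in> H" "r \<noteq> 0" "R = span {r}"
      by (auto simp: points_iff span_singleton_subset[OF subspace_H])
    let ?K = "\<sigma> (span {d})"
    \<comment> \<open>Here \<open>dim ?K\<close> is at least \<open>2 * e - 1\<close>, the case
      \<open>d = 0\<close> included, and \<open>e \<ge> 2\<close> leaves room to avoid
      \<open>r\<close>.\<close>
    have "e < dim ?K"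
      using dim_polar[OF subspace_span dim_d(2)] dim_d(1) e_ge_2 by linarith
    then obtain T where T: "subspace T" "T \<subseteq> ?K" "dim T = e" "r \<notin> T"
      using ex_dim_subspace_avoiding_nonzero[of ?K e r] r polar_subspace[OF subspace_span dim_d(2)] by blast
    have TH: "T \<subseteq> H"
      using T(2) polar_subspace(2)[OF subspace_span dim_d(2)] by simp
    have U: "\<sigma> T \<in> subspaces_of_dim H e"
      using polar_subspace[OF T(1) TH] dim_polar[OF T(1) TH] T(3) by (simp add: in_subspaces_of_dim)
    have "span {d} \<subseteq> \<sigma> T"
      using T(2) polar_swap[OF T(1) TH subspace_span dim_d(2)] by simp
    then have "d \<in> \<sigma> T" by (auto intro: span_base)
    then have "R \<in> twisted (span (insert x (\<sigma> T)))"
      using design_closure_twisted[OF R x U] xU[OF U] twisted_join_mem(1)[OF x U d] by blast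
    then show ?thesis
      using twisted_join_mem(2)[OF x U r(1,2)] r(3) T polar_polar[OF T(1) TH] by simp
  qed
qed

text \<open>A block through both points comes from a \<open>U\<close> with
  \<open>p \<in> \<sigma> U\<close>, equivalently \<open>U \<subseteq> \<sigma> (span {p})\<close>.
  Such \<open>U\<close> have only \<open>0\<close> in common, and their polars
  \<open>\<sigma> U\<close> have only \<open>span {p}\<close> in common.\<close>

lemma design_closure_mixed:
  assumes x: "x \<notin> H" and p: "p \<in> H" "p \<noteq> 0"
  shows "design_closure (span {x}) (span {p}) \<subseteq> {span {x}, span {p}}"
proof
  fix R assume R: "R \<in> design_closure (span {x}) (span {p})"
  have dim_p: "dim (span {p}) = 1" "span {p} \<subseteq> H"
    using p subspace_H by (auto simp: span_singleton_subset)
  have R_in: "R \<in> twisted (span (insert x U))" if U: "U \<in> subspaces_of_dim H e" "p \<in> \<sigma> U" for U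
  proof (rule design_closure_twisted[OF R x U(1)])
    show "span {x} \<in> twisted (span (insert x U))"
      using twisted_join_mem(1)[OF x U(1) subspace_0[OF subspace_H]] U
      by (auto simp: in_subspaces_of_dim subspace_0)
    show "span {p} \<in> twisted (span (insert x U))"
      using twisted_join_mem(2)[OF x U(1) p] U by simp
  qed
  show "R \<in> {span {x}, span {p}}"
  proof (cases "R \<in> points H")
    case False
    moreover have "R \<in> points UNIV" using R by (simp add: design_closure_def)
    ultimately obtain h where h: "h \<in> H" "R = span {x + h}"
      using affine_point[OF x] by blast
    have "h = 0"
    proof (rule ccontr)
      assume "h \<noteq> 0"
      let ?K = "\<sigma> (span {p})"
      have K: "subspace ?K" "?K \<subseteq> H"
        using polar_subspace[OF subspace_span dim_p(2)] by auto
      have "e < dim ?K"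
        using dim_polar[OF subspace_span dim_p(2)] dim_p(1) e_ge_2 by linarith
      then obtain U where U: "subspace U" "U \<subseteq> ?K" "dim U = e" "h \<notin> U"
        using ex_dim_subspace_avoiding_nonzero[OF K(1) _ \<open>h \<noteq> 0\<close>] by blast
      then have UH: "U \<in> subspaces_of_dim H e"
        using K by (auto simp: in_subspaces_of_dim)
      have "span {p} \<subseteq> \<sigma> U"
        using U K polar_swap[of U "span {p}"] dim_p(2) by auto
      then have "p \<in> \<sigma> U" by (auto intro: span_base)
      then show False
        using R_in[OF UH] twisted_join_mem(1)[OF x UH h(1)] h(2) U(4) by simp
    qed
    then show ?thesis using h by simp
  next
    case True
    then obtain r where r: "r \<in> H" "r \<noteq> 0" "R = span {r}"
      by (auto simp: points_iff span_singleton_subset[OF subspace_H])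
    have "r \<in> span {p}"
    proof (rule ccontr)
      assume "r \<notin> span {p}"
      then obtain T where T: "subspace T" "T \<subseteq> H" "span {p} \<subseteq> T" "dim T = e" "r \<notin> T"
        using ex_subspace_avoiding[OF subspace_span dim_p(2) subspace_H, of e r] dim_p(1) e_ge_2 dim_H
        by auto
      then have U: "\<sigma> T \<in> subspaces_of_dim H e"
        using polar_subspace[OF T(1,2)] dim_polar[OF T(1,2)] by (simp add: in_subspaces_of_dim)
      have "p \<in> T" using T(3) by (auto intro: span_base)
      then have "R \<in> twisted (span (insert x (\<sigma> T)))"
        using R_in[OF U] polar_polar[OF T(1,2)] by simp
      then show False
        using twisted_join_mem(2)[OF x U r(1,2)] r(3) T(5) polar_polar[OF T(1,2)] by simp
    qed
    then show ?thesis
      using r p span_singleton_eq by auto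
  qed
qed

text \<open>Every block meets \<open>H\<close> in the points of a subspace, either
  \<open>\<sigma> (W \<inter> H)\<close> or \<open>W\<close> itself, so with two points of
  \<open>H\<close> it contains the line joining them.\<close>

lemma span_pair_subset_design_closure:
  assumes x: "x \<in> H" "x \<noteq> 0" and y: "y \<in> H" "y \<noteq> 0" and z: "z \<in> span {x, y}" "z \<noteq> 0"
  shows "span {z} \<in> design_closure (span {x}) (span {y})"
proof -
  have pair: "z \<in> S" if "subspace S" "x \<in> S" "y \<in> S" for S
    using span_minimal[of "{x, y}" S] that z by auto
  have zH: "z \<in> H"
    using pair[OF subspace_H] x y by simp
  have "span {z} \<in> B" if B: "B \<in> blocks e H \<sigma>" "span {x} \<in> B" "span {y} \<in> B" for B
    using B(1) unfolding blocks_eq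
  proof
    assume "B \<in> twisted ` {W \<in> subspaces_of_dim UNIV (e + 1). \<not> W \<subseteq> H}"
    then obtain W where W: "subspace W" "B = twisted W"
      by (auto simp: in_subspaces_of_dim)
    then have "x \<in> \<sigma> (W \<inter> H)" "y \<in> \<sigma> (W \<inter> H)"
      using B x y by (simp_all add: twisted_mem)
    then have "z \<in> \<sigma> (W \<inter> H)"
      using pair[of "\<sigma> (W \<inter> H)"] polar_subspace(1)[of "W \<inter> H"] W subspace_H by (simp add: subspace_inter)
    then show ?thesis
      using W zH z by (simp add: twisted_mem)
  next
    assume "B \<in> points ` subspaces_of_dim H (e + 1)"
    then obtain W where W: "subspace W" "B = points W"
      by (auto simp: in_subspaces_of_dim)
    then show ?thesis
      using B pair[of W] x y z by (simp add: span_singleton_in_points)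
  qed
  then show ?thesis
    using z by (auto simp: design_closure_def points_iff)
qed

text \<open>The \<open>q\<close> points \<open>span {x + scale a y}\<close> and the remaining point
  \<open>span {y}\<close> of the line. A lower bound suffices, since closures of points off
  \<open>H\<close> have at most \<open>q\<close> points.\<close>

lemma card_design_closure_in_hyperplane:
  assumes x: "x \<in> H" "x \<noteq> 0" and y: "y \<in> H" "y \<noteq> 0" and xy: "x \<notin> span {y}"
  shows "\<exists>S \<subseteq> design_closure (span {x}) (span {y}). card S = card (UNIV :: 'k set) + 1"
proof -
  let ?L = "\<lambda>a. span {x + scale a y}"
  have nz: "x + scale a y \<noteq> 0" for a
    using xy by (auto simp: span_singleton add_eq_0_iff2 intro: range_eqI[of _ _ "- a"])
  have "inj ?L"
  proof (rule injI)
    fix a b assume "?L a = ?L b"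
    then have "x + scale a y \<in> ?L b"
      using span_base[of "x + scale a y" "{x + scale a y}"] by simp
    then obtain k where "scale 1 x + scale a y = scale k x + scale (k * b) y"
      by (auto simp: span_singleton scale_right_distrib)
    then show "a = b"
      using independent_coeffs[OF xy y(2)] by (metis mult_1)
  qed
  then have "card (range ?L) = card (UNIV :: 'k set)"
    by (rule card_image)
  moreover have "span {y} \<notin> range ?L"
  proof
    assume "span {y} \<in> range ?L"
    then obtain a where "span {y} = ?L a"
      by blast
    then have "x + scale a y \<in> span {y}"
      by (simp add: span_base)
    then show False
      using xy subspace_add_mem_iff[OF subspace_span, of "scale a y" "{y}" x]
      by (simp add: span_base span_scale)
  qed
  ultimately have "card (insert (span {y}) (range ?L)) = card (UNIV :: 'k set) + 1"
    by simp
  moreover have "x + scale a y \<in> span {x, y}" for a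
    by (intro span_add span_scale span_base) auto
  then have "insert (span {y}) (range ?L) \<subseteq> design_closure (span {x}) (span {y})"
    using span_pair_subset_design_closure[OF x y] nz y by (auto simp: span_base)
  ultimately show ?thesis
    by blast
qed

lemma card_subset_design_closure_affine:
  assumes P: "P \<in> points UNIV" "P \<notin> points H" and Q: "Q \<in> points UNIV"
    and S: "S \<subseteq> design_closure P Q"
  shows "card S \<le> card (UNIV :: 'k set)"
proof -
  obtain x where x: "x \<notin> H" "P = span {x}"
    using P by (metis points_iff span_singleton_in_points subspace_H)
  show ?thesis
  proof (cases "Q \<in> points H")
    case True
    then obtain p where p: "p \<in> H" "p \<noteq> 0" "Q = span {p}"
      by (auto simp: points_iff span_singleton_subset[OF subspace_H])
    have "card S \<le> card {P, Q}"
      using design_closure_mixed[OF x(1) p(1,2)] x p S by (intro card_mono) auto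
    \<comment> \<open>A mixed closure has at most two points, and \<open>2 \<le> q\<close> as
      \<open>0\<close> and \<open>1\<close> are distinct.\<close>
    also have "\<dots> \<le> card {0, 1 :: 'k}"
      by (simp add: card_insert_if)
    also have "\<dots> \<le> card (UNIV :: 'k set)"
      by (intro card_mono) auto
    finally show ?thesis .
  next
    case False
    then obtain d where d: "d \<in> H" "Q = span {x + d}"
      using affine_point[OF x(1) Q] by blast
    have "card S \<le> card (range (\<lambda>a. span {x + scale a d}))"
      using design_closure_affine[OF x(1) d(1)] x d S by (intro card_mono) auto
    also have "\<dots> \<le> card (UNIV :: 'k set)"
      by (intro card_image_le) simp
    finally show ?thesis .
  qed
qed

text \<open>A description of \<open>H\<close> by points and blocks alone. Asking for a subset of
  \<open>q + 1\<close> points makes the condition monotone in the closure, so an automorphism need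
  only map closures into closures.\<close>

lemma points_hyperplane_iff:
  assumes P: "P \<in> points UNIV"
  shows "P \<in> points H \<longleftrightarrow>
    (\<exists>Q\<in>points UNIV. \<exists>S \<subseteq> design_closure P Q. card S = card (UNIV :: 'k set) + 1)"
proof
  assume "P \<in> points H"
  then obtain y where y: "y \<in> H" "y \<noteq> 0" "P = span {y}"
    by (auto simp: points_iff span_singleton_subset[OF subspace_H])
  obtain x where x: "x \<in> H" "x \<notin> span {y}"
    using ex_not_mem_line[of H y] dim_H e_ge_2 by auto
  have "x \<noteq> 0"
    using x(2) span_zero by auto
  then show "\<exists>Q\<in>points UNIV. \<exists>S \<subseteq> design_closure P Q. card S = card (UNIV :: 'k set) + 1"
    using card_design_closure_in_hyperplane[OF x(1) _ y(1,2) x(2)] y(3)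
    by (metis design_closure_commute points_iff subset_UNIV)
next
  assume *: "\<exists>Q\<in>points UNIV. \<exists>S \<subseteq> design_closure P Q. card S = card (UNIV :: 'k set) + 1"
  show "P \<in> points H"
  proof (rule ccontr)
    assume "P \<notin> points H"
    obtain Q S where "Q \<in> points UNIV" "S \<subseteq> design_closure P Q" "card S = card (UNIV :: 'k set) + 1"
      using * by blast
    then show False
      using card_subset_design_closure_affine[OF P \<open>P \<notin> points H\<close>, of Q S] by simp
  qed
qed

section \<open>The automorphism group and its invariant hyperplane\<close>

lemma automorphism_bij:
  assumes "\<pi> \<in> design_automorphisms e H \<sigma>"
  shows "bij_betw \<pi> (points UNIV) (points UNIV)" "\<pi> \<in> extensional (points UNIV)"
    "(\<lambda>B. \<pi> ` B) ` blocks e H \<sigma> = blocks e H \<sigma>"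
  using assms by (auto simp: design_automorphisms_def Bij_def)

lemma automorphism_image_mem:
  assumes \<pi>: "\<pi> \<in> design_automorphisms e H \<sigma>" and B: "B \<in> blocks e H \<sigma>" and P: "P \<in> points UNIV"
  shows "\<pi> P \<in> \<pi> ` B \<longleftrightarrow> P \<in> B"
  using inj_on_image_mem_iff[OF _ P blocks_subset_points[OF B]] automorphism_bij(1)[OF \<pi>]
  by (auto simp: bij_betw_def)

lemma subgroup_design_automorphisms:
  "subgroup (design_automorphisms e H \<sigma>) (BijGroup (points UNIV))"
proof (rule subgroup.intro)
  show "design_automorphisms e H \<sigma> \<subseteq> carrier (BijGroup (points UNIV))"
    by (auto simp: design_automorphisms_def BijGroup_def)
next
  fix \<pi> \<rho> assume *: "\<pi> \<in> design_automorphisms e H \<sigma>" "\<rho> \<in> design_automorphisms e H \<sigma>"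
  have "compose (points UNIV) \<pi> \<rho> ` B = \<pi> ` \<rho> ` B" if "B \<in> blocks e H \<sigma>" for B
    using blocks_subset_points[OF that] by (force simp: compose_def)
  then have "(\<lambda>B. compose (points UNIV) \<pi> \<rho> ` B) ` blocks e H \<sigma> = (\<lambda>B. \<pi> ` B) ` (\<lambda>B. \<rho> ` B) ` blocks e H \<sigma>"
    by (simp add: image_image)
  also have "\<dots> = blocks e H \<sigma>"
    using * by (simp add: automorphism_bij(3))
  finally show "\<pi> \<otimes>\<^bsub>BijGroup (points UNIV)\<^esub> \<rho> \<in> design_automorphisms e H \<sigma>"
    using * by (simp add: BijGroup_def design_automorphisms_def compose_Bij)
next
  have "(\<lambda>P\<in>points UNIV. P) ` B = B" if "B \<in> blocks e H \<sigma>" for B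
    using blocks_subset_points[OF that] by force
  then show "\<one>\<^bsub>BijGroup (points UNIV)\<^esub> \<in> design_automorphisms e H \<sigma>"
    by (simp add: BijGroup_def design_automorphisms_def id_Bij)
next
  fix \<pi> assume \<pi>: "\<pi> \<in> design_automorphisms e H \<sigma>"
  let ?\<rho> = "restrict (inv_into (points UNIV) \<pi>) (points UNIV)"
  have "?\<rho> ` \<pi> ` B = B" if "B \<in> blocks e H \<sigma>" for B
  proof -
    have "?\<rho> (\<pi> P) = P" if "P \<in> B" for P
    proof -
      have "P \<in> points UNIV"
        using blocks_subset_points[OF \<open>B \<in> blocks e H \<sigma>\<close>] that by blast
      then show ?thesis
        using automorphism_bij(1)[OF \<pi>] by (simp add: bij_betw_apply bij_betw_inv_into_left)
    qed
    then have "(\<lambda>P. ?\<rho> (\<pi> P)) ` B = (\<lambda>P. P) ` B"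
      by (intro image_cong refl)
    then show ?thesis
      unfolding image_image by simp
  qed
  then have "(\<lambda>B. ?\<rho> ` B) ` (\<lambda>B. \<pi> ` B) ` blocks e H \<sigma> = blocks e H \<sigma>"
    by (simp add: image_image)
  then have "?\<rho> \<in> design_automorphisms e H \<sigma>"
    using \<pi> restrict_inv_into_Bij[of \<pi>] by (simp add: automorphism_bij(3)) (simp add: design_automorphisms_def)
  then show "inv\<^bsub>BijGroup (points UNIV)\<^esub> \<pi> \<in> design_automorphisms e H \<sigma>"
    using \<pi> by (simp add: inv_BijGroup design_automorphisms_def)
qed

text \<open>Every block through \<open>\<pi> P\<close> and \<open>\<pi> Q\<close> is the image of a
  block, which by injectivity passes through \<open>P\<close> and \<open>Q\<close>.\<close>

lemma automorphism_design_closure: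
  assumes \<pi>: "\<pi> \<in> design_automorphisms e H \<sigma>" and PQ: "P \<in> points UNIV" "Q \<in> points UNIV"
  shows "\<pi> ` design_closure P Q \<subseteq> design_closure (\<pi> P) (\<pi> Q)"
proof
  fix R' assume "R' \<in> \<pi> ` design_closure P Q"
  then obtain R where R: "R \<in> design_closure P Q" "R' = \<pi> R" by blast
  then have RV: "R \<in> points UNIV" by (simp add: design_closure_def)
  have "\<pi> R \<in> B'" if B': "B' \<in> blocks e H \<sigma>" "\<pi> P \<in> B'" "\<pi> Q \<in> B'" for B'
  proof -
    obtain B where B: "B \<in> blocks e H \<sigma>" "B' = \<pi> ` B"
      using B'(1) automorphism_bij(3)[OF \<pi>] by blast
    then show ?thesis
      using R(1) B' automorphism_image_mem[OF \<pi> B(1)] PQ by (auto simp: design_closure_def)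
  qed
  then show "R' \<in> design_closure (\<pi> P) (\<pi> Q)"
    using R(2) bij_betw_apply[OF automorphism_bij(1)[OF \<pi>] RV] by (simp add: design_closure_def)
qed

lemma automorphism_points_hyperplane_imp:
  assumes \<pi>: "\<pi> \<in> design_automorphisms e H \<sigma>" and P: "P \<in> points UNIV" "P \<in> points H"
  shows "\<pi> P \<in> points H"
proof -
  obtain Q S where Q: "Q \<in> points UNIV" and S: "S \<subseteq> design_closure P Q" "card S = card (UNIV :: 'k set) + 1"
    using points_hyperplane_iff[OF P(1)] P(2) by blast
  have "S \<subseteq> points UNIV"
    using S(1) by (auto simp: design_closure_def)
  then have "card (\<pi> ` S) = card (UNIV :: 'k set) + 1"
    using S(2) automorphism_bij(1)[OF \<pi>] by (metis bij_betw_def card_image inj_on_subset)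
  moreover have "\<pi> ` S \<subseteq> design_closure (\<pi> P) (\<pi> Q)"
    using automorphism_design_closure[OF \<pi> P(1) Q] S(1) by blast
  ultimately show ?thesis
    unfolding points_hyperplane_iff[OF bij_betw_apply[OF automorphism_bij(1)[OF \<pi>] P(1)]]
    using bij_betw_apply[OF automorphism_bij(1)[OF \<pi>] Q] by blast
qed

lemma automorphism_points_hyperplane_iff:
  assumes \<pi>: "\<pi> \<in> design_automorphisms e H \<sigma>" and P: "P \<in> points UNIV"
  shows "\<pi> P \<in> points H \<longleftrightarrow> P \<in> points H"
proof
  let ?\<rho> = "inv\<^bsub>BijGroup (points UNIV)\<^esub> \<pi>"
  assume "\<pi> P \<in> points H"
  then have "?\<rho> (\<pi> P) \<in> points H"
    using automorphism_points_hyperplane_imp subgroup.m_inv_closed[OF subgroup_design_automorphisms \<pi>]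
      bij_betw_apply[OF automorphism_bij(1)[OF \<pi>] P] by blast
  moreover have "?\<rho> (\<pi> P) = P"
    using \<pi> P automorphism_bij(1)[OF \<pi>] bij_betw_apply[OF automorphism_bij(1)[OF \<pi>] P]
    by (simp add: inv_BijGroup design_automorphisms_def bij_betw_inv_into_left)
  ultimately show "P \<in> points H" by simp
qed (use automorphism_points_hyperplane_imp[OF \<pi> P] in simp)

end

section \<open>Automorphisms off the hyperplane\<close>

context twisted_design
begin

text \<open>In the chart \<open>h \<mapsto> span {v + h}\<close> each twisted block shows a coset of
  its trace on \<open>H\<close>. The empty set is removed because the blocks inside \<open>H\<close>
  have no point in the chart.\<close>

lemma flats_eq_traces:
  assumes v: "v \<notin> H"
  shows "flats H e = (\<lambda>B. {h \<in> H. span {v + h} \<in> B}) ` blocks e H \<sigma> - {{}}"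
proof (intro equalityI subsetI)
  fix C assume C: "C \<in> flats H e"
  then obtain w U where w: "w \<in> H" and U: "U \<in> subspaces_of_dim H e" and CU: "C = (+) w ` U"
    by (auto simp: flats_def)
  have U': "subspace U" "U \<subseteq> H"
    using U by (auto simp: in_subspaces_of_dim)
  have vw: "v + w \<notin> H"
    using v w by (rule add_not_mem_hyperplane)
  have "{h \<in> H. span {v + h} \<in> twisted (span (insert (v + w) U))} = C"
  proof (rule Set.set_eqI)
    fix h
    show "h \<in> {h \<in> H. span {v + h} \<in> twisted (span (insert (v + w) U))} \<longleftrightarrow> h \<in> C"
    proof (cases "h \<in> H")
      case True
      \<comment> \<open>Rebasing the chart at \<open>v + w\<close> turns the coset of
        \<open>w\<close> into the subspace \<open>U\<close>.\<close>
      then have "span {v + w + (h - w)} \<in> twisted (span (insert (v + w) U)) \<longleftrightarrow> h - w \<in> U"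
        using twisted_join_mem(1)[OF vw U] w subspace_H by (simp only: subspace_diff)
      also have "h - w \<in> U \<longleftrightarrow> h \<in> C"
        unfolding CU by (auto intro!: image_eqI[of _ _ "h - w"])
      finally show ?thesis
        using True by simp
    qed (use flat_subset[OF subspace_H C] in auto)
  qed
  moreover have "twisted (span (insert (v + w) U)) \<in> blocks e H \<sigma>"
    using join_off_hyperplane[OF vw U] by (intro twisted_in_blocks) auto
  moreover have "C \<noteq> {}"
    using subspace_0[OF U'(1)] CU by auto
  ultimately show "C \<in> (\<lambda>B. {h \<in> H. span {v + h} \<in> B}) ` blocks e H \<sigma> - {{}}"
    by blast
next
  fix C assume "C \<in> (\<lambda>B. {h \<in> H. span {v + h} \<in> B}) ` blocks e H \<sigma> - {{}}"
  then obtain B w where B: "B \<in> blocks e H \<sigma>" "C = {h \<in> H. span {v + h} \<in> B}"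
    and w: "w \<in> H" "span {v + w} \<in> B"
    by blast
  have vh: "v + h \<notin> H" if "h \<in> H" for h
    using v that by (rule add_not_mem_hyperplane)
  obtain W where W: "W \<in> subspaces_of_dim UNIV (e + 1)" "\<not> W \<subseteq> H" "B = twisted W"
    using block_off_hyperplane[OF B(1) w(2) vh[OF w(1)]] .
  have sW: "subspace W"
    using W by (simp add: in_subspaces_of_dim)
  have mem: "span {v + h} \<in> B \<longleftrightarrow> v + h \<in> W" if "h \<in> H" for h
    using twisted_mem[OF sW] vh[OF that] not_mem_hyperplane_nonzero W(3) by auto
  have vw: "v + w \<in> W"
    using mem w by simp
  have "v + h \<in> W \<longleftrightarrow> h - w \<in> W" for h
    using subspace_add_mem_iff[OF sW vw, of "h - w"] by (simp add: add.commute)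
  then have "C = {h \<in> H. h - w \<in> W}"
    using B(2) mem by auto
  also have "\<dots> = (+) w ` (W \<inter> H)"
  proof (intro equalityI subsetI)
    fix h assume "h \<in> {h \<in> H. h - w \<in> W}"
    then show "h \<in> (+) w ` (W \<inter> H)"
      using w subspace_H by (intro image_eqI[of _ _ "h - w"]) (auto simp: subspace_diff)
  qed (use w subspace_H in \<open>auto simp: subspace_add\<close>)
  finally show "C \<in> flats H e"
    using dim_inter_hyperplane[OF W(1,2)] w(1) unfolding flats_def by blast
qed

text \<open>\<open>g\<close> is \<open>\<pi>\<close> written in the chart given by \<open>v\<close>;
  this is possible because \<open>\<pi>\<close> maps points off \<open>H\<close> to points off
  \<open>H\<close>.\<close>

lemma automorphism_flat_map:
  assumes \<pi>: "\<pi> \<in> design_automorphisms e H \<sigma>" and v: "v \<notin> H"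
  obtains g where "flat_map H e g" "\<And>h. h \<in> H \<Longrightarrow> \<pi> (span {v + h}) = span {v + g h}"
proof -
  note bij = automorphism_bij(1)[OF \<pi>]
  have pt: "span {v + h} \<in> points UNIV" "span {v + h} \<notin> points H" if "h \<in> H" for h
    using add_not_mem_hyperplane[OF v that] not_mem_hyperplane_nonzero
      span_singleton_in_points[OF subspace_H] span_singleton_in_points[OF subspace_UNIV] by auto
  define g where "g h = (SOME k. k \<in> H \<and> \<pi> (span {v + h}) = span {v + k})" for h
  have g: "g h \<in> H \<and> \<pi> (span {v + h}) = span {v + g h}" if h: "h \<in> H" for h
  proof -
    have "\<pi> (span {v + h}) \<in> points UNIV" "\<pi> (span {v + h}) \<notin> points H"
      using pt[OF h] automorphism_points_hyperplane_iff[OF \<pi>] bij_betw_apply[OF bij] by auto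
    then obtain k where "k \<in> H \<and> \<pi> (span {v + h}) = span {v + k}"
      using affine_point[OF v] by blast
    then show ?thesis
      unfolding g_def by (rule someI)
  qed
  have "inj_on g H"
  proof (rule inj_onI)
    fix h k assume hk: "h \<in> H" "k \<in> H" "g h = g k"
    then have "\<pi> (span {v + h}) = \<pi> (span {v + k})"
      using g by simp
    then have "span {v + h} = span {v + k}"
      using bij pt hk by (auto simp: bij_betw_def inj_on_def)
    then show "h = k"
      using span_eq_affine_iff[OF v hk(1,2)] by simp
  qed
  moreover have "g ` H = H"
  proof
    show "H \<subseteq> g ` H"
    proof
      fix k assume k: "k \<in> H"
      obtain P where P: "P \<in> points UNIV" "\<pi> P = span {v + k}"
        using pt(1)[OF k] bij_betw_imp_surj_on[OF bij] by (metis (no_types, lifting) imageE)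
      then have "P \<notin> points H"
        using pt(2)[OF k] automorphism_points_hyperplane_iff[OF \<pi> P(1)] by simp
      then obtain h where h: "h \<in> H" "P = span {v + h}"
        using affine_point[OF v P(1)] by blast
      then have "span {v + g h} = span {v + k}"
        using P g by simp
      then have "g h = k"
        using span_eq_affine_iff[OF v] g h k by simp
      then show "k \<in> g ` H"
        using h by blast
    qed
  qed (use g in auto)
  ultimately have bij_g: "bij_betw g H H"
    by (simp add: bij_betw_def)
  let ?tr = "\<lambda>B. {h \<in> H. span {v + h} \<in> B}"
  have tr: "g ` ?tr B = ?tr (\<pi> ` B)" if B: "B \<in> blocks e H \<sigma>" for B
  proof -
    have iff: "span {v + g h} \<in> \<pi> ` B \<longleftrightarrow> span {v + h} \<in> B" if "h \<in> H" for h
      using automorphism_image_mem[OF \<pi> B pt(1)[OF that]] g[OF that] by simp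
    show ?thesis
    proof
      show "g ` ?tr B \<subseteq> ?tr (\<pi> ` B)"
        using iff g by auto
      show "?tr (\<pi> ` B) \<subseteq> g ` ?tr B"
      proof
        fix k assume k: "k \<in> ?tr (\<pi> ` B)"
        then obtain h where "h \<in> H" "k = g h"
          using \<open>g ` H = H\<close> by blast
        then show "k \<in> g ` ?tr B"
          using iff k by auto
      qed
    qed
  qed
  \<comment> \<open>Only the empty set has empty image, so discarding it commutes with taking
    images.\<close>
  have "(\<lambda>C. g ` C) ` flats H e = (\<lambda>B. g ` ?tr B) ` blocks e H \<sigma> - {{}}"
    unfolding flats_eq_traces[OF v] by blast
  also have "(\<lambda>B. g ` ?tr B) ` blocks e H \<sigma> = ?tr ` (\<lambda>B. \<pi> ` B) ` blocks e H \<sigma>"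
    using tr by (simp only: image_image cong: image_cong)
  also have "(\<lambda>B. \<pi> ` B) ` blocks e H \<sigma> = blocks e H \<sigma>"
    by (rule automorphism_bij(3)[OF \<pi>])
  finally have "(\<lambda>C. g ` C) ` flats H e = flats H e"
    unfolding flats_eq_traces[OF v] .
  then show thesis
    using that bij_g g by (auto simp: flat_map_def)
qed

section \<open>From the affine chart to a semilinear map of the whole space\<close>

text \<open>The space is the direct sum of the line of \<open>v\<close> and \<open>H\<close>:
  \<open>v\<close> is sent to \<open>u\<close>, \<open>f\<close> acts on \<open>H\<close>, and
  \<open>\<tau>\<close> acts on the coordinate along \<open>v\<close>. Since \<open>u\<close> is off
  \<open>H\<close>, the result is bijective and stabilises \<open>H\<close>.\<close>

lemma semilinear_extension:
  assumes v: "v \<notin> H" and u: "u \<notin> H" and \<tau>: "field_automorphism \<tau>"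
    and bij: "bij_betw f H H"
    and add: "\<And>x y. x \<in> H \<Longrightarrow> y \<in> H \<Longrightarrow> f (x + y) = f x + f y"
    and scale: "\<And>a x. x \<in> H \<Longrightarrow> f (scale a x) = scale (\<tau> a) (f x)"
  obtains \<phi> where "\<phi> \<in> carrier (GammaL_stab H)" "\<And>h. h \<in> H \<Longrightarrow> \<phi> (v + h) = u + f h"
proof -
  have \<tau>1: "\<tau> 1 = 1" and \<tau>_add: "\<And>a b. \<tau> (a + b) = \<tau> a + \<tau> b"
    and \<tau>_mult: "\<And>a b. \<tau> (a * b) = \<tau> a * \<tau> b" and \<tau>_bij: "bij \<tau>"
    using \<tau> by (auto simp: field_automorphism_def)
  have \<tau>0: "\<tau> 0 = 0"
    using \<tau>_add[of 0 0] by (metis add.right_neutral add_left_cancel)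
  have fH: "f x \<in> H" if "x \<in> H" for x
    using bij_betw_apply[OF bij that] .
  have f0: "f 0 = 0"
    using add[of 0 0] subspace_0[OF subspace_H] by simp
  have off: "scale a w \<in> H \<longleftrightarrow> a = 0" if "w \<notin> H" for a w
    using scale_mem_iff[OF subspace_H, of a w] that subspace_0[OF subspace_H] by (cases "a = 0") auto
  \<comment> \<open>The linear functional with kernel \<open>H\<close> and value \<open>1\<close> at
    \<open>v\<close>.\<close>
  define c where "c x = (SOME a. x - scale a v \<in> H)" for x
  have c: "x - scale (c x) v \<in> H" for x
    unfolding c_def using hyperplane_coordinate[OF v] by (rule someI_ex)
  have c_unique: "c x = a" if "x - scale a v \<in> H" for x a
  proof -
    have "(x - scale a v) - (x - scale (c x) v) \<in> H"
      using that c subspace_H by (blast intro: subspace_diff)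
    then have "scale (c x - a) v \<in> H"
      by (simp add: algebra_simps)
    then show ?thesis
      using off[OF v] by simp
  qed
  have c_add: "c (x + y) = c x + c y" for x y
  proof (rule c_unique)
    have "(x - scale (c x) v) + (y - scale (c y) v) \<in> H"
      using c subspace_H by (blast intro: subspace_add)
    then show "x + y - scale (c x + c y) v \<in> H"
      by (simp add: algebra_simps)
  qed
  have c_scale: "c (scale a x) = a * c x" for a x
  proof (rule c_unique)
    have "scale a (x - scale (c x) v) \<in> H"
      using c subspace_H by (blast intro: subspace_scale)
    then show "scale a x - scale (a * c x) v \<in> H"
      by (simp add: algebra_simps)
  qed
  have c_H: "c x = 0 \<longleftrightarrow> x \<in> H" for x
    using c_unique[of x 0] c[of x] by auto
  define \<phi> where "\<phi> x = scale (\<tau> (c x)) u + f (x - scale (c x) v)" for x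
  have \<phi>_H: "\<phi> x = f x" if "x \<in> H" for x
    using that c_H[of x] by (simp add: \<phi>_def \<tau>0)
  have \<phi>_add: "\<phi> (x + y) = \<phi> x + \<phi> y" for x y
  proof -
    have "x + y - scale (c x + c y) v = (x - scale (c x) v) + (y - scale (c y) v)"
      by (simp add: algebra_simps)
    then have "f (x + y - scale (c x + c y) v) = f (x - scale (c x) v) + f (y - scale (c y) v)"
      by (simp only: add[OF c c])
    then show ?thesis
      by (simp add: \<phi>_def c_add \<tau>_add scale_left_distrib)
  qed
  have \<phi>_scale: "\<phi> (scale a x) = scale (\<tau> a) (\<phi> x)" for a x
  proof -
    have "scale a x - scale (a * c x) v = scale a (x - scale (c x) v)"
      by (simp add: algebra_simps)
    then have "f (scale a x - scale (a * c x) v) = scale (\<tau> a) (f (x - scale (c x) v))"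
      by (simp only: scale[OF c])
    then show ?thesis
      by (simp add: \<phi>_def c_scale \<tau>_mult scale_right_distrib)
  qed
  have \<phi>_mem: "\<phi> x \<in> H \<longleftrightarrow> x \<in> H" for x
  proof -
    have "\<phi> x \<in> H \<longleftrightarrow> scale (\<tau> (c x)) u \<in> H"
      unfolding \<phi>_def using subspace_add_mem_iff[OF subspace_H fH[OF c]] .
    also have "\<dots> \<longleftrightarrow> c x = 0"
      using off[OF u] \<tau>_bij \<tau>0 by (metis bij_def injD)
    finally show ?thesis
      by (simp add: c_H)
  qed
  have "inj \<phi>"
  proof (rule injI)
    fix x y assume "\<phi> x = \<phi> y"
    then have 0: "\<phi> (x - y) = 0"
      using \<phi>_add[of "x - y" y] by simp
    then have xy: "x - y \<in> H"
      using \<phi>_mem[of "x - y"] subspace_0[OF subspace_H] by simp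
    then have "f (x - y) = f 0"
      using 0 \<phi>_H f0 by simp
    then have "x - y = 0"
      using inj_onD[OF bij_betw_imp_inj_on[OF bij]] xy subspace_0[OF subspace_H] by blast
    then show "x = y" by simp
  qed
  moreover have "surj \<phi>"
    unfolding surj_def
  proof
    fix y
    obtain b where b: "y - scale b u \<in> H"
      using hyperplane_coordinate[OF u] by blast
    obtain h where h: "h \<in> H" "f h = y - scale b u"
      using bij b by (metis bij_betw_imp_surj_on imageE)
    obtain a where a: "\<tau> a = b"
      using \<tau>_bij by (metis bij_pointE)
    have "c (scale a v + h) = a"
      using h by (intro c_unique) simp
    then have "\<phi> (scale a v + h) = y"
      using a h by (simp add: \<phi>_def)
    then show "\<exists>x. y = \<phi> x" by blast
  qed
  ultimately have "bij \<phi>"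
    by (simp add: bij_def)
  moreover have "semilinear \<phi>"
    unfolding semilinear_def using \<phi>_add \<phi>_scale \<tau> by blast
  moreover have "\<phi> ` H = H"
    using bij \<phi>_H by (simp add: bij_betw_def)
  moreover have "\<phi> (v + h) = u + f h" if "h \<in> H" for h
  proof -
    have "c (v + h) = 1"
      using that by (intro c_unique) simp
    then show ?thesis
      by (simp add: \<phi>_def \<tau>1)
  qed
  ultimately show thesis
    using that by (simp add: GammaL_stab_def Bij_def)
qed

lemma automorphism_off_hyperplane:
  assumes \<pi>: "\<pi> \<in> design_automorphisms e H \<sigma>"
  obtains \<phi> where "\<phi> \<in> carrier (GammaL_stab H)"
    "\<And>x. x \<notin> H \<Longrightarrow> \<pi> (span {x}) = \<phi> ` span {x}"
proof -
  obtain v where v: "v \<notin> H"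
    using dim_H dim_V dim_subset[of UNIV H] by auto
  obtain g where g: "flat_map H e g" "\<And>h. h \<in> H \<Longrightarrow> \<pi> (span {v + h}) = span {v + g h}"
    using automorphism_flat_map[OF \<pi> v] by blast
  have H0: "0 \<in> H"
    using subspace_0[OF subspace_H] .
  have g0: "g 0 \<in> H"
    using g(1) H0 by (auto simp: flat_map_def bij_betw_def)
  \<comment> \<open>The translation part \<open>g 0\<close> is split off and absorbed into the image
    \<open>v + g 0\<close> of \<open>v\<close>.\<close>
  let ?f = "\<lambda>h. g h - g 0"
  have f: "flat_map H e ?f" "?f 0 = 0"
    using flat_map_centered[OF subspace_H g(1) H0] by simp_all
  have e: "e < dim H"
    using dim_H e_ge_2 by simp
  obtain \<tau> where \<tau>: "field_automorphism \<tau>" "\<And>a x. x \<in> H \<Longrightarrow> ?f (scale a x) = scale (\<tau> a) (?f x)"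
    using flat_map_scale[OF subspace_H f e_ge_2 e finite] by blast
  have "bij_betw ?f H H"
    using f(1) by (simp add: flat_map_def)
  then obtain \<phi> where \<phi>: "\<phi> \<in> carrier (GammaL_stab H)" "\<And>h. h \<in> H \<Longrightarrow> \<phi> (v + h) = v + g 0 + ?f h"
    using semilinear_extension[OF v add_not_mem_hyperplane[OF v g0] \<tau>(1) _
        flat_map_add[OF subspace_H f e_ge_2 e] \<tau>(2)] by blast
  have "\<pi> (span {x}) = \<phi> ` span {x}" if x: "x \<notin> H" for x
  proof -
    obtain a where a: "v - scale a x \<in> H"
      using hyperplane_coordinate[OF x] by blast
    then have a0: "a \<noteq> 0"
      using v by auto
    \<comment> \<open>Rescaling \<open>x\<close> to \<open>scale a x = v + ?h\<close> puts its point
      into the chart.\<close>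
    let ?h = "scale a x - v"
    have h: "?h \<in> H"
      using subspace_neg[OF subspace_H a] by simp
    have x_eq: "span {x} = span {v + ?h}"
      using span_singleton_eq[of "scale a x" x] a0 not_mem_hyperplane_nonzero[OF x]
      by (auto simp: span_singleton)
    then have "\<pi> (span {x}) = span {v + g ?h}"
      using g(2)[OF h] by simp
    also have "\<dots> = span (\<phi> ` {v + ?h})"
      using \<phi>(2)[OF h] by simp
    also have "\<dots> = \<phi> ` span {x}"
      using \<phi>(1) by (simp add: x_eq GammaL_stab_iff semilinear_image_span)
    finally show ?thesis .
  qed
  then show thesis
    using that \<phi>(1) by blast
qed

end

section \<open>The induced automorphisms\<close>

context twisted_design
begin

lemma GammaL_stab_mem:
  assumes \<phi>: "\<phi> \<in> carrier (GammaL_stab H)"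
  shows "\<phi> x \<in> H \<longleftrightarrow> x \<in> H"
  using \<phi> inj_image_mem_iff[of \<phi> x H] by (simp add: GammaL_stab_iff bij_is_inj)

lemma GammaL_stab_image_subspace:
  assumes \<phi>: "\<phi> \<in> carrier (GammaL_stab H)" and U: "subspace U"
  shows "subspace (\<phi> ` U)" "dim (\<phi> ` U) = dim U" "\<phi> ` U \<subseteq> H \<longleftrightarrow> U \<subseteq> H"
proof -
  show "subspace (\<phi> ` U)" "dim (\<phi> ` U) = dim U"
    using \<phi> U by (simp_all add: GammaL_stab_iff semilinear_image_subspace dim_semilinear_image)
  show "\<phi> ` U \<subseteq> H \<longleftrightarrow> U \<subseteq> H"
    by (simp add: subset_eq GammaL_stab_mem[OF \<phi>])
qed

lemma GammaL_stab_image_subset_iff: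
  assumes \<phi>: "\<phi> \<in> carrier (GammaL_stab H)"
  shows "\<phi> ` U \<subseteq> \<phi> ` W \<longleftrightarrow> U \<subseteq> W"
  using \<phi> by (simp add: GammaL_stab_iff bij_is_inj inj_image_subset_iff)

lemma GammaL_stab_image_inter:
  assumes \<phi>: "\<phi> \<in> carrier (GammaL_stab H)"
  shows "\<phi> ` W \<inter> H = \<phi> ` (W \<inter> H)"
  using GammaL_stab_mem[OF \<phi>] by auto

lemma polar_conjugate:
  assumes \<phi>: "\<phi> \<in> carrier (GammaL_stab H)" and U: "subspace U" "U \<subseteq> H"
  shows "subspace (\<sigma> (\<phi> ` \<sigma> U))" "\<sigma> (\<phi> ` \<sigma> U) \<subseteq> H" "dim (\<sigma> (\<phi> ` \<sigma> U)) = dim U"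
proof -
  have 1: "subspace (\<phi> ` \<sigma> U)" "\<phi> ` \<sigma> U \<subseteq> H" "dim (\<phi> ` \<sigma> U) = dim (\<sigma> U)"
    using GammaL_stab_image_subspace[OF \<phi> polar_subspace(1)[OF U]] polar_subspace(2)[OF U] by auto
  show "subspace (\<sigma> (\<phi> ` \<sigma> U))" "\<sigma> (\<phi> ` \<sigma> U) \<subseteq> H"
    using polar_subspace[OF 1(1,2)] by auto
  show "dim (\<sigma> (\<phi> ` \<sigma> U)) = dim U"
    using dim_polar[OF 1(1,2)] dim_polar[OF U] 1(3) by linarith
qed

text \<open>The two reversals by \<open>\<sigma>\<close> cancel, so the conjugate of
  \<open>\<phi>\<close> preserves inclusion in both directions.\<close>

lemma polar_conjugate_subset_iff:
  assumes \<phi>: "\<phi> \<in> carrier (GammaL_stab H)" and U: "subspace U" "U \<subseteq> H" and W: "subspace W" "W \<subseteq> H"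
  shows "\<sigma> (\<phi> ` \<sigma> U) \<subseteq> \<sigma> (\<phi> ` \<sigma> W) \<longleftrightarrow> U \<subseteq> W"
proof -
  have sub: "subspace (\<phi> ` \<sigma> X)" "\<phi> ` \<sigma> X \<subseteq> H" if "subspace X" "X \<subseteq> H" for X
    using GammaL_stab_image_subspace[OF \<phi> polar_subspace(1)[OF that]] polar_subspace(2)[OF that] by auto
  have "\<sigma> (\<phi> ` \<sigma> U) \<subseteq> \<sigma> (\<phi> ` \<sigma> W) \<longleftrightarrow> \<sigma> W \<subseteq> \<sigma> U"
    using polar_subset_iff[OF sub[OF W] sub[OF U]] GammaL_stab_image_subset_iff[OF \<phi>] by simp
  also have "\<dots> \<longleftrightarrow> U \<subseteq> W"
    by (rule polar_subset_iff[OF U W])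
  finally show ?thesis .
qed

lemma points_subset: "P \<in> points W \<Longrightarrow> subspace P \<and> P \<subseteq> W \<and> dim P = 1"
  by (simp add: points_def)

lemma induced_map_on_hyperplane:
  assumes "P \<in> points H"
  shows "induced_map H \<sigma> \<phi> P = \<sigma> (\<phi> ` \<sigma> P)"
  using assms by (simp add: induced_map_def points_def)

lemma induced_map_off_hyperplane:
  assumes "P \<in> points UNIV" "P \<notin> points H"
  shows "induced_map H \<sigma> \<phi> P = \<phi> ` P"
  using assms by (simp add: induced_map_def)

lemma induced_map_in_points:
  assumes \<phi>: "\<phi> \<in> carrier (GammaL_stab H)" and P: "P \<in> points UNIV"
  shows "induced_map H \<sigma> \<phi> P \<in> points UNIV" "induced_map H \<sigma> \<phi> P \<in> points H \<longleftrightarrow> P \<in> points H"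
proof -
  have "induced_map H \<sigma> \<phi> P \<in> points UNIV \<and> (induced_map H \<sigma> \<phi> P \<in> points H \<longleftrightarrow> P \<in> points H)"
  proof (cases "P \<in> points H")
    case True
    then have "subspace P" "P \<subseteq> H" "dim P = 1"
      using points_subset by blast+
    then show ?thesis
      using polar_conjugate[OF \<phi>, of P] True by (simp add: induced_map_on_hyperplane points_def)
  next
    case False
    have "subspace P" "dim P = 1"
      using points_subset[OF P] by auto
    then show ?thesis
      using GammaL_stab_image_subspace[OF \<phi>, of P] P False
      by (simp add: induced_map_off_hyperplane) (simp add: points_def)
  qed
  then show "induced_map H \<sigma> \<phi> P \<in> points UNIV" "induced_map H \<sigma> \<phi> P \<in> points H \<longleftrightarrow> P \<in> points H"
    by auto
qed

lemma induced_map_comp: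
  assumes \<phi>: "\<phi> \<in> carrier (GammaL_stab H)" and \<psi>: "\<psi> \<in> carrier (GammaL_stab H)"
    and P: "P \<in> points UNIV"
  shows "induced_map H \<sigma> (\<phi> \<circ> \<psi>) P = induced_map H \<sigma> \<phi> (induced_map H \<sigma> \<psi> P)"
proof (cases "P \<in> points H")
  case True
  then have P': "subspace P" "P \<subseteq> H"
    using points_subset by blast+
  have "induced_map H \<sigma> \<phi> (induced_map H \<sigma> \<psi> P) = \<sigma> (\<phi> ` \<sigma> (\<sigma> (\<psi> ` \<sigma> P)))"
    using True induced_map_in_points[OF \<psi> P] by (simp add: induced_map_on_hyperplane)
  moreover have "\<sigma> (\<sigma> (\<psi> ` \<sigma> P)) = \<psi> ` \<sigma> P"
    using GammaL_stab_image_subspace[OF \<psi> polar_subspace(1)[OF P']] polar_subspace(2)[OF P']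
    by (intro polar_polar) auto
  ultimately show ?thesis
    using True by (simp add: induced_map_on_hyperplane image_comp)
next
  case False
  then show ?thesis
    using P induced_map_in_points[OF \<psi> P] by (simp add: induced_map_off_hyperplane image_comp)
qed

lemma induced_map_scale:
  assumes c: "c \<noteq> 0" and P: "P \<in> points UNIV"
  shows "induced_map H \<sigma> (scale c) P = P"
proof -
  have im: "scale c ` U = U" if "subspace U" for U
  proof
    show "U \<subseteq> scale c ` U"
    proof
      fix x assume "x \<in> U"
      then have "scale (inverse c) x \<in> U" "x = scale c (scale (inverse c) x)"
        using that c by (auto intro: subspace_scale)
      then show "x \<in> scale c ` U" by blast
    qed
  qed (use that in \<open>auto intro: subspace_scale\<close>)
  show ?thesis
  proof (cases "P \<in> points H")
    case True
    then have "subspace P" "P \<subseteq> H"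
      using points_subset by blast+
    then show ?thesis
      using True by (simp add: induced_map_on_hyperplane im polar_subspace polar_polar)
  next
    case False
    then show ?thesis
      using P points_subset[OF P] by (simp add: induced_map_off_hyperplane im)
  qed
qed

lemma induced_map_inverse:
  assumes \<phi>: "\<phi> \<in> carrier (GammaL_stab H)" and P: "P \<in> points UNIV"
  shows "induced_map H \<sigma> (inv_into UNIV \<phi>) (induced_map H \<sigma> \<phi> P) = P"
    and "induced_map H \<sigma> \<phi> (induced_map H \<sigma> (inv_into UNIV \<phi>) P) = P"
proof -
  have bij: "bij \<phi>"
    using \<phi> by (simp add: GammaL_stab_iff)
  \<comment> \<open>Writing the identity as \<open>scale 1\<close> makes
    \<open>induced_map_scale\<close> applicable.\<close>
  have "inv_into UNIV \<phi> \<circ> \<phi> = scale 1" "\<phi> \<circ> inv_into UNIV \<phi> = scale 1"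
    using bij by (auto simp: fun_eq_iff bij_is_inj bij_is_surj surj_f_inv_f)
  then show "induced_map H \<sigma> (inv_into UNIV \<phi>) (induced_map H \<sigma> \<phi> P) = P"
    "induced_map H \<sigma> \<phi> (induced_map H \<sigma> (inv_into UNIV \<phi>) P) = P"
    using induced_map_comp[OF inv_in_GammaL_stab[OF \<phi>] \<phi> P]
      induced_map_comp[OF \<phi> inv_in_GammaL_stab[OF \<phi>] P] induced_map_scale[of 1 P] P by auto
qed

lemma induced_map_Bij:
  assumes \<phi>: "\<phi> \<in> carrier (GammaL_stab H)"
  shows "induced_map H \<sigma> \<phi> \<in> Bij (points UNIV)"
proof -
  have "bij_betw (induced_map H \<sigma> \<phi>) (points UNIV) (points UNIV)"
    using induced_map_inverse[OF \<phi>] induced_map_in_points[OF \<phi>] induced_map_in_points[OF inv_in_GammaL_stab[OF \<phi>]]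
    by (intro bij_betw_byWitness[where f' = "induced_map H \<sigma> (inv_into UNIV \<phi>)"]) auto
  then show ?thesis
    by (simp add: Bij_def induced_map_def)
qed

lemma induced_map_image_eqI:
  assumes \<phi>: "\<phi> \<in> carrier (GammaL_stab H)" and AB: "A \<subseteq> points UNIV" "B \<subseteq> points UNIV"
    and iff: "\<And>P. P \<in> points UNIV \<Longrightarrow> induced_map H \<sigma> \<phi> P \<in> B \<longleftrightarrow> P \<in> A"
  shows "induced_map H \<sigma> \<phi> ` A = B"
proof
  show "B \<subseteq> induced_map H \<sigma> \<phi> ` A"
  proof
    fix Q assume Q: "Q \<in> B"
    let ?P = "induced_map H \<sigma> (inv_into UNIV \<phi>) Q"
    have "?P \<in> points UNIV" "Q = induced_map H \<sigma> \<phi> ?P"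
      using induced_map_in_points[OF inv_in_GammaL_stab[OF \<phi>]] induced_map_inverse(2)[OF \<phi>] Q AB by auto
    then show "Q \<in> induced_map H \<sigma> \<phi> ` A"
      using iff[of ?P] Q by (metis imageI)
  qed
qed (use AB iff in auto)

lemma induced_map_twisted:
  assumes \<phi>: "\<phi> \<in> carrier (GammaL_stab H)" and W: "subspace W"
  shows "induced_map H \<sigma> \<phi> ` twisted W = twisted (\<phi> ` W)"
proof (rule induced_map_image_eqI[OF \<phi>])
  have sW: "subspace (W \<inter> H)" "W \<inter> H \<subseteq> H"
    using W subspace_H by (auto simp: subspace_inter)
  have sub: "subspace (\<sigma> (W \<inter> H))" "\<sigma> (W \<inter> H) \<subseteq> H"
    using polar_subspace[OF sW] .
  fix P assume P: "P \<in> points UNIV"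
  show "induced_map H \<sigma> \<phi> P \<in> twisted (\<phi> ` W) \<longleftrightarrow> P \<in> twisted W"
  proof (cases "P \<in> points H")
    case True
    then have P': "subspace P" "P \<subseteq> H" "dim P = 1"
      using points_subset by blast+
    have tw: "Q \<in> twisted X \<longleftrightarrow> Q \<subseteq> \<sigma> (X \<inter> H)" if "Q \<in> points H" for Q X
      using that by (auto simp: twisted_def points_def)
    have "induced_map H \<sigma> \<phi> P \<in> twisted (\<phi> ` W) \<longleftrightarrow> induced_map H \<sigma> \<phi> P \<subseteq> \<sigma> (\<phi> ` W \<inter> H)"
      using induced_map_in_points[OF \<phi> P] True by (simp add: tw)
    also have "\<dots> \<longleftrightarrow> \<sigma> (\<phi> ` \<sigma> P) \<subseteq> \<sigma> (\<phi> ` \<sigma> (\<sigma> (W \<inter> H)))"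
      using True sW by (simp add: induced_map_on_hyperplane polar_polar GammaL_stab_image_inter[OF \<phi>])
    also have "\<dots> \<longleftrightarrow> P \<subseteq> \<sigma> (W \<inter> H)"
      by (rule polar_conjugate_subset_iff[OF \<phi> P'(1,2) sub])
    also have "\<dots> \<longleftrightarrow> P \<in> twisted W"
      using True by (simp add: tw)
    finally show ?thesis .
  next
    case False
    then obtain x where x: "x \<noteq> 0" "P = span {x}" "x \<notin> H"
      using P by (metis points_iff span_singleton_in_points subspace_H)
    have \<phi>x: "\<phi> x \<notin> H" "\<phi> x \<noteq> 0"
      using x GammaL_stab_mem[OF \<phi>] not_mem_hyperplane_nonzero by auto
    have "induced_map H \<sigma> \<phi> P = span {\<phi> x}"
      using P False x(2) \<phi> by (simp add: induced_map_off_hyperplane GammaL_stab_iff semilinear_image_span)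
    then show ?thesis
      using twisted_mem[OF W, of x] twisted_mem[OF GammaL_stab_image_subspace(1)[OF \<phi> W], of "\<phi> x"] x \<phi>x \<phi>
      by (simp add: GammaL_stab_iff bij_is_inj inj_image_mem_iff)
  qed
qed (auto simp: twisted_def points_def)

lemma induced_map_points:
  assumes \<phi>: "\<phi> \<in> carrier (GammaL_stab H)" and W: "subspace W" "W \<subseteq> H"
  shows "induced_map H \<sigma> \<phi> ` points W = points (\<sigma> (\<phi> ` \<sigma> W))"
proof (rule induced_map_image_eqI[OF \<phi>])
  fix P assume P: "P \<in> points UNIV"
  show "induced_map H \<sigma> \<phi> P \<in> points (\<sigma> (\<phi> ` \<sigma> W)) \<longleftrightarrow> P \<in> points W"
  proof (cases "P \<in> points H")
    case True
    then have P': "subspace P" "P \<subseteq> H" "dim P = 1"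
      using points_subset by blast+
    then show ?thesis
      using polar_conjugate_subset_iff[OF \<phi> P'(1,2) W] induced_map_in_points[OF \<phi> P] True
      by (simp add: induced_map_on_hyperplane) (simp add: points_def)
  next
    case False
    then have "induced_map H \<sigma> \<phi> P \<notin> points H"
      using induced_map_in_points[OF \<phi> P] by simp
    then show ?thesis
      using False W polar_conjugate(2)[OF \<phi> W] by (auto simp: points_def)
  qed
qed (auto simp: points_def)

lemma induced_map_automorphism:
  assumes \<phi>: "\<phi> \<in> carrier (GammaL_stab H)"
  shows "induced_map H \<sigma> \<phi> \<in> design_automorphisms e H \<sigma>"
proof -
  have block: "induced_map H \<sigma> \<psi> ` B \<in> blocks e H \<sigma>"
    if \<psi>: "\<psi> \<in> carrier (GammaL_stab H)" and B: "B \<in> blocks e H \<sigma>" for \<psi> B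
  proof -
    consider W where "subspace W" "dim W = e + 1" "\<not> W \<subseteq> H" "B = twisted W"
      | W where "subspace W" "dim W = e + 1" "W \<subseteq> H" "B = points W"
      using B by (auto simp: blocks_eq in_subspaces_of_dim)
    then show ?thesis
    proof cases
      case (1 W)
      then show ?thesis
        using twisted_in_blocks[of "\<psi> ` W"] GammaL_stab_image_subspace[OF \<psi> 1(1)]
        by (simp add: induced_map_twisted[OF \<psi>] in_subspaces_of_dim)
    next
      case (2 W)
      then show ?thesis
        using polar_conjugate[OF \<psi> 2(1,3)]
        by (simp add: induced_map_points[OF \<psi>] blocks_eq in_subspaces_of_dim)
    qed
  qed
  have "B \<in> (\<lambda>B. induced_map H \<sigma> \<phi> ` B) ` blocks e H \<sigma>" if B: "B \<in> blocks e H \<sigma>" for B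
  proof
    show "induced_map H \<sigma> (inv_into UNIV \<phi>) ` B \<in> blocks e H \<sigma>"
      by (rule block[OF inv_in_GammaL_stab[OF \<phi>] B])
    have "(\<lambda>P. induced_map H \<sigma> \<phi> (induced_map H \<sigma> (inv_into UNIV \<phi>) P)) ` B = (\<lambda>P. P) ` B"
      using blocks_subset_points[OF B] by (intro image_cong refl induced_map_inverse(2)[OF \<phi>]) auto
    then show "B = induced_map H \<sigma> \<phi> ` induced_map H \<sigma> (inv_into UNIV \<phi>) ` B"
      by (simp add: image_image)
  qed
  then show ?thesis
    using block[OF \<phi>] induced_map_Bij[OF \<phi>] by (auto simp: design_automorphisms_def)
qed

text \<open>A block off \<open>H\<close> is determined by its points off \<open>H\<close>, so the two automorphisms agree on
  all sets \<open>points T\<close> with \<open>T \<subseteq> H\<close> of dimension \<open>e\<close>; these separate the points of \<open>H\<close>.\<close>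

lemma automorphism_eqI:
  assumes \<pi>: "\<pi> \<in> design_automorphisms e H \<sigma>" and \<rho>: "\<rho> \<in> design_automorphisms e H \<sigma>"
    and eq: "\<And>P. P \<in> points UNIV \<Longrightarrow> P \<notin> points H \<Longrightarrow> \<pi> P = \<rho> P"
  shows "\<pi> = \<rho>"
proof (rule extensionalityI[OF automorphism_bij(2)[OF \<pi>] automorphism_bij(2)[OF \<rho>]])
  obtain v where v: "v \<notin> H"
    using dim_H dim_V dim_subset[of UNIV H] by auto
  have off: "Q \<in> \<alpha> ` B \<longleftrightarrow> (\<exists>P\<in>B - points H. Q = \<alpha> P)"
    if \<alpha>: "\<alpha> \<in> design_automorphisms e H \<sigma>" and B: "B \<in> blocks e H \<sigma>" and Q: "Q \<notin> points H" for \<alpha> B Q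
    using automorphism_points_hyperplane_iff[OF \<alpha>] blocks_subset_points[OF B] Q by blast
  \<comment> \<open>Both images are twisted blocks with the same points off \<open>H\<close>, so the
    underlying subspaces coincide, and with them the parts inside \<open>H\<close>.\<close>
  have image_eq: "\<pi> ` B = \<rho> ` B" if B: "B \<in> blocks e H \<sigma>" and x: "x \<notin> H" "span {x} \<in> B" for B x
  proof -
    have in_blocks: "\<pi> ` B \<in> blocks e H \<sigma>" "\<rho> ` B \<in> blocks e H \<sigma>"
      using automorphism_bij(3)[OF \<pi>] automorphism_bij(3)[OF \<rho>] B by blast+
    have same: "Q \<in> \<pi> ` B \<longleftrightarrow> Q \<in> \<rho> ` B" if "Q \<notin> points H" for Q
      unfolding off[OF \<pi> B that] off[OF \<rho> B that]
      using eq blocks_subset_points[OF B] by (intro bex_cong refl) auto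
    have P: "span {x} \<in> points UNIV" "span {x} \<notin> points H"
      using x span_singleton_in_points[OF subspace_H] not_mem_hyperplane_nonzero blocks_subset_points[OF B] by auto
    have "\<pi> (span {x}) \<in> points UNIV" "\<pi> (span {x}) \<notin> points H"
      using P automorphism_points_hyperplane_iff[OF \<pi>] bij_betw_apply[OF automorphism_bij(1)[OF \<pi>]] by auto
    then obtain y where y: "y \<notin> H" "\<pi> (span {x}) = span {y}"
      by (metis points_iff span_singleton_in_points subspace_H)
    have "span {y} \<in> \<pi> ` B" "span {y} \<in> \<rho> ` B"
      using x(2) y(2) eq[OF P] by (metis imageI)+
    then obtain W W' where W: "W \<in> subspaces_of_dim UNIV (e + 1)" "\<not> W \<subseteq> H" "\<pi> ` B = twisted W"
      and W': "W' \<in> subspaces_of_dim UNIV (e + 1)" "\<not> W' \<subseteq> H" "\<rho> ` B = twisted W'"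
      using block_off_hyperplane[OF in_blocks(1) _ y(1)] block_off_hyperplane[OF in_blocks(2) _ y(1)] by metis
    have sub: "subspace W" "subspace W'"
      using W W' by (auto simp: in_subspaces_of_dim)
    have "z \<in> W \<longleftrightarrow> z \<in> W'" if "z \<notin> H" for z
    proof -
      have "span {z} \<notin> points H"
        using that span_singleton_in_points[OF subspace_H] not_mem_hyperplane_nonzero by simp
      then show ?thesis
        using same[of "span {z}"] twisted_mem[OF sub(1), of z] twisted_mem[OF sub(2), of z] W(3) W'(3)
          that not_mem_hyperplane_nonzero by simp
    qed
    then have "W - H = W' - H"
      by blast
    then have "W = W'"
      by (rule off_hyperplane_determines[OF sub W(2)])
    then show ?thesis
      using W(3) W'(3) by simp
  qed
  fix P assume P: "P \<in> points UNIV"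
  show "\<pi> P = \<rho> P"
  proof (cases "P \<in> points H")
    case False
    with P eq show ?thesis by simp
  next
    case True
    then obtain p where p: "p \<in> H" "p \<noteq> 0" "P = span {p}"
      by (auto simp: points_iff span_singleton_subset[OF subspace_H])
    have "\<pi> P \<in> points UNIV" "\<pi> P \<in> points H"
      using bij_betw_apply[OF automorphism_bij(1)[OF \<pi>] P] automorphism_points_hyperplane_iff[OF \<pi> P] True by auto
    then obtain R where R: "R \<in> points UNIV" "\<pi> P = \<rho> R"
      using bij_betw_imp_surj_on[OF automorphism_bij(1)[OF \<rho>]] by (metis (no_types, lifting) imageE)
    then have "R \<in> points H"
      using automorphism_points_hyperplane_iff[OF \<rho> R(1)] \<open>\<pi> P \<in> points H\<close> by simp
    then obtain r where r: "r \<in> H" "r \<noteq> 0" "R = span {r}"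
      by (auto simp: points_iff span_singleton_subset[OF subspace_H])
    have "r \<in> span {p}"
    proof (rule ccontr)
      assume "r \<notin> span {p}"
      moreover have "span {p} \<subseteq> H" "dim (span {p}) = 1"
        using p by (auto simp: span_singleton_subset[OF subspace_H])
      ultimately obtain T where T: "subspace T" "span {p} \<subseteq> T" "T \<subseteq> H" "dim T = e" "r \<notin> T"
        using ex_subspace_avoiding[OF subspace_span _ subspace_H, of "{p}" e r] e_ge_2 dim_H by auto
      have "p \<in> T" using T(2) by (auto intro: span_base)
      \<comment> \<open>Joining \<open>v\<close> with \<open>\<sigma> T\<close> produces a block
        whose part in \<open>H\<close> is \<open>points T\<close>; it contains \<open>P\<close> but
        not \<open>R\<close>.\<close>
      have U: "\<sigma> T \<in> subspaces_of_dim H e"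
        using polar_subspace[OF T(1,3)] dim_polar[OF T(1,3)] T(4) by (simp add: in_subspaces_of_dim)
      let ?B = "twisted (span (insert v (\<sigma> T)))"
      have B: "?B \<in> blocks e H \<sigma>"
        using join_off_hyperplane[OF v U] by (intro twisted_in_blocks) auto
      have "0 \<in> \<sigma> T"
        using U subspace_0 by (simp add: in_subspaces_of_dim)
      then have "span {v} \<in> ?B"
        using twisted_join_mem(1)[OF v U subspace_0[OF subspace_H]] by simp
      then have "\<pi> ` ?B = \<rho> ` ?B"
        using image_eq[OF B v] by simp
      moreover have "P \<in> ?B"
        using twisted_join_mem(2)[OF v U p(1,2)] p(3) polar_polar[OF T(1,3)] \<open>p \<in> T\<close> by simp
      ultimately have "\<rho> R \<in> \<rho> ` ?B"
        using R(2) by (metis imageI)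
      then have "R \<in> ?B"
        using automorphism_image_mem[OF \<rho> B R(1)] by simp
      then show False
        using twisted_join_mem(2)[OF v U r(1,2)] r(3) polar_polar[OF T(1,3)] T(5) by simp
    qed
    then have "R = P"
      using r p span_singleton_eq by simp
    then show ?thesis
      using R(2) by simp
  qed
qed

theorem automorphism_induced:
  assumes \<pi>: "\<pi> \<in> design_automorphisms e H \<sigma>"
  shows "\<exists>\<phi>\<in>carrier (GammaL_stab H). \<pi> = induced_map H \<sigma> \<phi>"
proof -
  obtain \<phi> where \<phi>: "\<phi> \<in> carrier (GammaL_stab H)" "\<And>x. x \<notin> H \<Longrightarrow> \<pi> (span {x}) = \<phi> ` span {x}"
    using automorphism_off_hyperplane[OF \<pi>] by blast
  have "\<pi> = induced_map H \<sigma> \<phi>"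
  proof (rule automorphism_eqI[OF \<pi> induced_map_automorphism[OF \<phi>(1)]])
    fix P assume P: "P \<in> points UNIV" "P \<notin> points H"
    then obtain x where "x \<notin> H" "P = span {x}"
      by (metis points_iff span_singleton_in_points subspace_H)
    then show "\<pi> P = induced_map H \<sigma> \<phi> P"
      using \<phi>(2) P by (simp add: induced_map_off_hyperplane)
  qed
  with \<phi>(1) show ?thesis by blast
qed

section \<open>The kernel and the isomorphism\<close>

lemma scale_in_GammaL_stab:
  assumes c: "c \<noteq> 0"
  shows "scale c \<in> carrier (GammaL_stab H)"
proof -
  have "bij (scale c)"
    using c by (intro o_bij[of "scale (inverse c)"]) (auto simp: fun_eq_iff)
  moreover have "semilinear (scale c)"
    by (auto simp: semilinear_def scale_right_distrib field_automorphism_def mult.commute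
        intro!: exI[of _ "\<lambda>a. a"] bij_id[unfolded id_def])
  moreover have "scale c ` H = H"
  proof
    show "H \<subseteq> scale c ` H"
    proof
      fix x assume "x \<in> H"
      then have "scale (inverse c) x \<in> H" "x = scale c (scale (inverse c) x)"
        using c subspace_H by (auto intro: subspace_scale)
      then show "x \<in> scale c ` H" by blast
    qed
  qed (use subspace_H in \<open>auto intro: subspace_scale\<close>)
  ultimately show ?thesis
    by (simp add: GammaL_stab_iff)
qed

text \<open>Every vector off \<open>H\<close> is multiplied by some factor. Comparing
  \<open>x\<close> with \<open>x + h\<close> forces equal factors, so \<open>\<phi>\<close> acts on
  \<open>H\<close> by the factor of any vector off \<open>H\<close>, and all these factors agree.
  Additivity is enough for this; no linearity is presupposed.\<close>

lemma fixes_off_hyperplane_scalar: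
  assumes \<phi>: "\<phi> \<in> carrier (GammaL_stab H)" and fix_pts: "\<And>x. x \<notin> H \<Longrightarrow> \<phi> ` span {x} = span {x}"
  shows "\<phi> \<in> scalar_maps"
proof -
  have semi: "semilinear \<phi>" and bij: "bij \<phi>"
    using \<phi> by (auto simp: GammaL_stab_iff)
  have add: "\<phi> (x + y) = \<phi> x + \<phi> y" for x y
    using semi by (simp add: semilinear_def)
  have \<phi>H: "\<phi> h \<in> H" if "h \<in> H" for h
    using GammaL_stab_mem[OF \<phi>] that by simp
  have ex: "\<exists>c. \<phi> x = scale c x" if x: "x \<notin> H" for x
  proof -
    have "\<phi> x \<in> \<phi> ` span {x}"
      by (simp add: span_base)
    then show ?thesis
      using fix_pts[OF x] by (auto simp: span_singleton)
  qed
  have on_H: "\<phi> h = scale c h" if x: "x \<notin> H" "\<phi> x = scale c x" and h: "h \<in> H" for c x h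
  proof -
    obtain d where "\<phi> (x + h) = scale d (x + h)"
      using ex[OF add_not_mem_hyperplane[OF x(1) h]] by blast
    then have eq: "\<phi> h = scale (d - c) x + scale d h"
      by (simp add: add x(2) algebra_simps)
    then have "scale (d - c) x \<in> H"
      using \<phi>H[OF h] subspace_add_mem_iff[OF subspace_H, of "scale d h"] h subspace_scale[OF subspace_H] by simp
    then have "d = c"
      using scale_mem_iff[OF subspace_H, of "d - c" x] x(1) by auto
    with eq show ?thesis by simp
  qed
  obtain v where v: "v \<notin> H"
    using dim_H dim_V dim_subset[of UNIV H] by auto
  obtain c where c: "\<phi> v = scale c v"
    using ex[OF v] by blast
  \<comment> \<open>A test vector: its factor under \<open>\<phi>\<close> equals that of every
    vector off \<open>H\<close>.\<close>
  obtain w where w: "w \<in> H" "w \<noteq> 0"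
    using dim_H e_ge_2 dim_eq_0[of H] by auto
  have "\<phi> x = scale c x" for x
  proof (cases "x \<in> H")
    case True
    then show ?thesis by (rule on_H[OF v c])
  next
    case False
    obtain d where d: "\<phi> x = scale d x"
      using ex[OF False] by blast
    have "scale d w = scale c w"
      unfolding on_H[OF False d w(1), symmetric] by (rule on_H[OF v c w(1)])
    then show ?thesis
      using d w(2) by simp
  qed
  then have eq: "\<phi> = scale c"
    by (simp add: fun_eq_iff)
  moreover have "c \<noteq> 0"
  proof
    assume "c = 0"
    then have "\<phi> w = \<phi> 0"
      using eq by simp
    then show False
      using bij w(2) by (metis bij_def injD)
  qed
  ultimately show ?thesis
    by (auto simp: scalar_maps_def)
qed

text \<open>The first isomorphism theorem for \<open>induced_map H \<sigma>\<close>, a surjective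
  homomorphism whose kernel is \<open>scalar_maps\<close>.\<close>

theorem Aut_design_iso: "Aut_design e H \<sigma> \<cong> PGammaL_stab H"
proof -
  have group_Aut: "group (Aut_design e H \<sigma>)"
    unfolding Aut_design_def by (rule subgroup.subgroup_is_group[OF subgroup_design_automorphisms group_BijGroup])
  have carrier_Aut: "carrier (Aut_design e H \<sigma>) = design_automorphisms e H \<sigma>"
    by (simp add: Aut_design_def)
  let ?h = "induced_map H \<sigma>"
  have "?h \<in> hom (GammaL_stab H) (Aut_design e H \<sigma>)"
  proof (rule homI)
    fix \<phi> \<psi> assume *: "\<phi> \<in> carrier (GammaL_stab H)" "\<psi> \<in> carrier (GammaL_stab H)"
    have "?h (\<phi> \<circ> \<psi>) = compose (points UNIV) (?h \<phi>) (?h \<psi>)"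
    proof
      fix P
      show "?h (\<phi> \<circ> \<psi>) P = compose (points UNIV) (?h \<phi>) (?h \<psi>) P"
        using induced_map_comp[OF *, of P] by (cases "P \<in> points UNIV") (simp_all add: compose_def induced_map_def)
    qed
    then show "?h (\<phi> \<otimes>\<^bsub>GammaL_stab H\<^esub> \<psi>) = ?h \<phi> \<otimes>\<^bsub>Aut_design e H \<sigma>\<^esub> ?h \<psi>"
      using * by (simp add: mult_GammaL_stab Aut_design_def BijGroup_def induced_map_Bij)
  qed (simp add: carrier_Aut induced_map_automorphism)
  then interpret h: group_hom "GammaL_stab H" "Aut_design e H \<sigma>" ?h
    using group_GammaL_stab group_Aut by (simp add: group_hom_def group_hom_axioms_def)
  have one: "\<one>\<^bsub>Aut_design e H \<sigma>\<^esub> = (\<lambda>P\<in>points UNIV. P)"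
    by (simp add: Aut_design_def BijGroup_def)
  have "kernel (GammaL_stab H) (Aut_design e H \<sigma>) ?h = scalar_maps"
  proof (intro equalityI subsetI)
    fix \<phi> assume "\<phi> \<in> kernel (GammaL_stab H) (Aut_design e H \<sigma>) ?h"
    then have \<phi>: "\<phi> \<in> carrier (GammaL_stab H)" "?h \<phi> = (\<lambda>P\<in>points UNIV. P)"
      by (auto simp: kernel_def one)
    show "\<phi> \<in> scalar_maps"
    proof (rule fixes_off_hyperplane_scalar[OF \<phi>(1)])
      fix x assume x: "x \<notin> H"
      then have P: "span {x} \<in> points UNIV" "span {x} \<notin> points H"
        using span_singleton_in_points[OF subspace_H] span_singleton_in_points[OF subspace_UNIV]
          not_mem_hyperplane_nonzero by auto
      then show "\<phi> ` span {x} = span {x}"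
        using induced_map_off_hyperplane[OF P, of \<phi>] \<phi>(2) by simp
    qed
  next
    fix \<phi> assume "\<phi> \<in> scalar_maps"
    then obtain c where c: "c \<noteq> 0" "\<phi> = scale c"
      by (auto simp: scalar_maps_def)
    then have "?h \<phi> = (\<lambda>P\<in>points UNIV. P)"
      using induced_map_scale[OF c(1)]
      by (intro extensionalityI[of _ "points UNIV"]) (simp_all add: induced_map_def)
    then show "\<phi> \<in> kernel (GammaL_stab H) (Aut_design e H \<sigma>) ?h"
      using scale_in_GammaL_stab[OF c(1)] c(2) by (simp add: kernel_def one)
  qed
  moreover have "?h ` carrier (GammaL_stab H) = carrier (Aut_design e H \<sigma>)"
    using automorphism_induced induced_map_automorphism by (auto simp: carrier_Aut image_iff)
  ultimately have "PGammaL_stab H \<cong> Aut_design e H \<sigma>"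
    using h.FactGroup_iso by (simp add: PGammaL_stab_def)
  \<comment> \<open>The isomorphism theorem starts from the quotient; reversing the isomorphism
    requires it to be a group, and \<open>scalar_maps\<close> is normal as a kernel.\<close>
  moreover have "group (PGammaL_stab H)"
    using h.normal_kernel \<open>kernel (GammaL_stab H) (Aut_design e H \<sigma>) ?h = scalar_maps\<close>
    by (simp add: PGammaL_stab_def normal.factorgroup_is_group)
  ultimately show ?thesis
    by (simp add: group.iso_sym)
qed

end

theorem theorem2:
  fixes scale :: "'k::{field,finite} \<Rightarrow> 'v::ab_group_add \<Rightarrow> 'v"
    and q e :: nat
    and H :: "'v set"
    and \<sigma> :: "'v set \<Rightarrow> 'v set"
  assumes "primepow q" and "card (UNIV :: 'k set) = q"
    and "e \<ge> 2"
    and "vector_space scale"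
    and "vector_space.dim scale (UNIV :: 'v set) = 2 * e + 1"
    and "module.subspace scale H"
    and "vector_space.dim scale H = 2 * e"
    and "projective_geometry.polarity scale H \<sigma>"
  shows "(\<forall>\<pi> \<in> projective_geometry.design_automorphisms scale e H \<sigma>.
            \<exists>\<phi> \<in> carrier (projective_geometry.GammaL_stab scale H).
              \<pi> = projective_geometry.induced_map scale H \<sigma> \<phi>)
       \<and> projective_geometry.Aut_design scale e H \<sigma> \<cong> projective_geometry.PGammaL_stab scale H"
proof -
  interpret vector_space scale by fact
  obtain B where B: "independent B" "UNIV \<subseteq> span B" "card B = dim (UNIV :: 'v set)"
    using basis_exists by blast
  \<comment> \<open>An infinite basis would have \<open>card\<close> equal to the default
    \<open>0\<close>, whereas the dimension \<open>2 * e + 1\<close> is positive.\<close>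
  have "finite B"
    using B(3) assms(5) by (metis add_is_0 card.infinite zero_neq_one)
  then interpret twisted_design scale B H e \<sigma>
    using B assms by unfold_locales auto
  show ?thesis
    using automorphism_induced Aut_design_iso by blast
qed

end
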